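(* Let $K$ be a real quadratic number field of discriminant $\Delta$. Then each narrow ideal class in $K$ gives rise to an integral solution of the equation $$\mathcal{L}_{2k}(x_{1},y_{1},\ldots,x_{k},y_{k})^{2} - 4 = z^{2}\Delta$$ for some positive integer $k$ and for some $z \in \mathbf{Z}$ which depends only on $K$.
   Context: **Multivariate Lucas polynomials.** Put $M(x,y) = \begin{pmatrix} 1+xy & x \\ y & 1 \end{pmatrix}$ and $M(x_{1},y_{1},\ldots,x_{k},y_{k}) = M(x_{1},y_{1})\cdots M(x_{k},y_{k})$. Write this matrix as $A_k I + B_k\sigma_1 + C_k\sigma_2 + D_k\sigma_3$, where $I$ is the identity, $\sigma_{1} = \begin{pmatrix} 0 & 1 \\ 1 & 0 \end{pmatrix}$, $\sigma_{2} = \begin{pmatrix} 0 & -\sqrt{-1} \\ \sqrt{-1} & 0 \end{pmatrix}$, $\sigma_{3} = \begin{pmatrix} 1 & 0 \\ 0 & -1 \end{pmatrix}$ are the Pauli matrices, and $A_k,B_k,C_k,D_k$ are polynomials in $x_1,y_1,\ldots,x_k,y_k$. The $2k$-th multivariate Lucas polynomial is $\mathcal{L}_{2k} := 2A_k$, i.e. the trace of $M(x_{1},y_{1},\ldots,x_{k},y_{k})$; it has integer coefficients. **Narrow ideal classes.** Let $\mathbf{Z}_K$ be the ring of integers of $K$, and let $\overline{\alpha}$ denote the Galois conjugate of $\alpha\in K$. Two fractional ideals $\mathfrak{a},\mathfrak{b}$ of $K$ are equivalent if $\mathfrak{a}=\lambda\mathfrak{b}$ for some $\lambda\in K$ of positive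 norm; the equivalence classes are the narrow ideal classes of $K$. **Background: tuples attached to a narrow ideal class.** The norm of $\mathfrak{a}$ is $N(\mathfrak{a}) = \xi^{-2}[\mathbf{Z}_K:\xi\mathfrak{a}]$ for a nonzero $\xi\in\mathbf{Z}$ with $\xi\mathfrak{a}\subset\mathbf{Z}_K$. For a $\mathbf{Z}$-basis $(\alpha,\beta)$ of $\mathfrak{a}$ that is oriented, i.e. $\overline{\alpha}\beta-\alpha\overline{\beta}>0$, put $f_{\mathfrak{a}}(X,Y) = \frac{(X\alpha+Y\beta)(X\overline{\alpha}+Y\overline{\beta})}{N(\mathfrak{a})} = aX^2+bXY+cY^2$, a primitive integral indefinite binary quadratic form of discriminant $b^2-4ac=\Delta$. Let $(x_o,z_o)$ be the fundamental solution of the Pell equation $X^2-\Delta Z^2=4$, i.e. the one with the smallest positive second component among all integral solutions. The fundamental automorphism of $\mathfrak{a}$ is $$W_{f_{\mathfrak{a}}} = \begin{pmatrix} \frac{x_o-z_ob}{2} & -cz_o\\ az_o & \frac{x_o+z_ob}{2} \end{pmatrix}\in \mathrm{PSL}_2(\mathbf{Z}),$$ a generator of the stabilizer of $f_{\mathfrak{a}}$ in $\mathrm{PSL}_2(\mathbf{Z})$. Let $S = \begin{pmatrix} 0&-1\\1&0 \end{pmatrix}$ and $L = \begin{pmatrix} 1&-1\\1&0 \end{pmatrix}$, which freely generate $\mathrm{PSL}_2(\mathbf{Z})\cong \mathbf{Z}/2\mathbf{Z}*\mathbf{Z}/3\mathbf{Z}$. The conjugacy class of $W_{f_{\mathfrak{a}}}$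 contains elements of the form $(LS)^{m_{1}}(L^{2}S)^{n_{1}} \cdots (LS)^{m_{l}}(L^{2}S)^{n_{l}}$ with all $m_i,n_i\geq 1$; to each such element one associates the tuple $(m_1,n_1,\ldots,m_l,n_l)$. It is by way of such tuples that narrow ideal classes are related to integral solutions of the equation. *)

theory Defs
  imports
    "HOL-Computational_Algebra.Polynomial"
    "HOL-Analysis.Determinants"
    "HOL-Algebra.Coset"
begin

definition mat2 :: "'a::zero \<Rightarrow> 'a \<Rightarrow> 'a \<Rightarrow> 'a \<Rightarrow> 'a^2^2" where
  "mat2 p q r s = vector [vector [p, q], vector [r, s]]"

lemma mat2_nth [simp]:
  "mat2 p q r s $ 1 $ 1 = p" "mat2 p q r s $ 1 $ 2 = q"
  "mat2 p q r s $ 2 $ 1 = r" "mat2 p q r s $ 2 $ 2 = s"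
  by (simp_all add: mat2_def)

text \<open>
  The polynomial is given by its values: a list of \<open>k\<close> pairs
  \<open>[(x\<^sub>1, y\<^sub>1), \<dots>, (x\<^sub>k, y\<^sub>k)]\<close> stands for the arguments
  \<open>x\<^sub>1, y\<^sub>1, \<dots>, x\<^sub>k, y\<^sub>k\<close>, so the index \<open>2k\<close> is twice the length of the list.
\<close>

definition lucas_matrix1 :: "'a::comm_ring_1 \<Rightarrow> 'a \<Rightarrow> 'a^2^2" where
  "lucas_matrix1 x y = mat2 (1 + x * y) x y 1"

primrec lucas_matrix :: "('a::comm_ring_1 \<times> 'a) list \<Rightarrow> 'a^2^2" where
  "lucas_matrix [] = mat 1"
| "lucas_matrix (p # ps) = lucas_matrix1 (fst p) (snd p) ** lucas_matrix ps"

definition lucas :: "('a::comm_ring_1 \<times> 'a) list \<Rightarrow> 'a" where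
  "lucas ps = trace (lucas_matrix ps)"

definition pauli1 :: "complex^2^2" where "pauli1 = mat2 0 1 1 0"
definition pauli2 :: "complex^2^2" where "pauli2 = mat2 0 (- \<i>) \<i> 0"
definition pauli3 :: "complex^2^2" where "pauli3 = mat2 1 0 0 (-1)"

text \<open>
  The trace is twice the coefficient of the identity in the decomposition of the matrix
  with respect to the Pauli matrices.
\<close>

lemma pauli_decomposition_ex:
  fixes T :: "complex^2^2"
  shows "\<exists>A B C D. T = mat A + mat B ** pauli1 + mat C ** pauli2 + mat D ** pauli3"
proof -
  have "T = mat ((T$1$1 + T$2$2) / 2) + mat ((T$1$2 + T$2$1) / 2) ** pauli1
      + mat (\<i> * (T$1$2 - T$2$1) / 2) ** pauli2 + mat ((T$1$1 - T$2$2) / 2) ** pauli3"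
    by (simp add: vec_eq_iff forall_2 matrix_matrix_mult_def sum_2 mat_def
        pauli1_def pauli2_def pauli3_def field_simps)
  then show ?thesis by blast
qed

lemma lucas_eq_pauli_coeff:
  fixes ps :: "(complex \<times> complex) list"
  assumes "lucas_matrix ps = mat A + mat B ** pauli1 + mat C ** pauli2 + mat D ** pauli3"
  shows "lucas ps = 2 * A"
  by (simp add: lucas_def assms trace_def sum_2 matrix_matrix_mult_def mat_def
      pauli1_def pauli2_def pauli3_def)

lemma lucas_matrix_of_int:
  "lucas_matrix (map (map_prod of_int of_int) ps) $ i $ j
    = (of_int (lucas_matrix ps $ i $ j) :: 'a::comm_ring_1)"
proof (induction ps arbitrary: i j)
  case Nil
  then show ?case by (simp add: mat_def)
next
  case (Cons p ps)
  have "lucas_matrix1 (of_int (fst p)) (of_int (snd p)) $ i $ k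
      = (of_int (lucas_matrix1 (fst p) (snd p) $ i $ k) :: 'a)" for k
    using exhaust_2[of i] exhaust_2[of k] by (auto simp: lucas_matrix1_def)
  then show ?case by (simp add: matrix_matrix_mult_def Cons.IH)
qed

lemma lucas_of_int:
  "lucas (map (map_prod of_int of_int) ps) = (of_int (lucas ps) :: 'a::comm_ring_1)"
  by (simp add: lucas_def trace_def lucas_matrix_of_int)

text \<open>
  A real quadratic field is taken together with one of its two embeddings into the reals:
  it is a subfield of the reals of degree 2 over the rationals. Fixing an embedding is needed
  to speak of the sign of \<open>\<alpha>' * \<beta> - \<alpha> * \<beta>'\<close>.
\<close>

definition real_quadratic_field :: "real set \<Rightarrow> bool" where
  "real_quadratic_field K \<longleftrightarrow>
     0 \<in> K \<and> 1 \<in> K \<and>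
     (\<forall>x\<in>K. \<forall>y\<in>K. x + y \<in> K \<and> x - y \<in> K \<and> x * y \<in> K) \<and>
     (\<forall>x\<in>K. inverse x \<in> K) \<and>
     vector_space.dim (\<lambda>(q::rat) (x::real). of_rat q * x) K = 2"

definition ring_of_integers :: "real set \<Rightarrow> real set" where
  "ring_of_integers K = {x \<in> K. algebraic_int x}"

text \<open>The unique nontrivial automorphism of \<open>K\<close>, extended by the identity outside \<open>K\<close>.\<close>

definition galois_conj :: "real set \<Rightarrow> real \<Rightarrow> real" where
  "galois_conj K = (THE \<sigma>.
     bij_betw \<sigma> K K \<and> \<sigma> 1 = 1 \<and>
     (\<forall>x\<in>K. \<forall>y\<in>K. \<sigma> (x + y) = \<sigma> x + \<sigma> y \<and> \<sigma> (x * y) = \<sigma> x * \<sigma> y) \<and>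
     (\<exists>x\<in>K. \<sigma> x \<noteq> x) \<and> (\<forall>x. x \<notin> K \<longrightarrow> \<sigma> x = x))"

definition Z_basis :: "real set \<Rightarrow> real \<Rightarrow> real \<Rightarrow> bool" where
  "Z_basis A \<alpha> \<beta> \<longleftrightarrow>
     bij_betw (\<lambda>(m::int, n::int). of_int m * \<alpha> + of_int n * \<beta>) UNIV A"

definition field_discriminant :: "real set \<Rightarrow> int" where
  "field_discriminant K = (THE \<Delta>. \<exists>\<omega>\<^sub>1 \<omega>\<^sub>2. Z_basis (ring_of_integers K) \<omega>\<^sub>1 \<omega>\<^sub>2 \<and>
     of_int \<Delta> = (\<omega>\<^sub>1 * galois_conj K \<omega>\<^sub>2 - galois_conj K \<omega>\<^sub>1 * \<omega>\<^sub>2)\<^sup>2)"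

definition fractional_ideals :: "real set \<Rightarrow> real set set" where
  "fractional_ideals K = {A. A \<subseteq> K \<and> 0 \<in> A \<and> A \<noteq> {0} \<and>
     (\<forall>x\<in>A. \<forall>y\<in>A. x + y \<in> A) \<and> (\<forall>r\<in>ring_of_integers K. \<forall>x\<in>A. r * x \<in> A) \<and>
     (\<exists>\<xi>\<in>ring_of_integers K. \<xi> \<noteq> 0 \<and> (\<lambda>x. \<xi> * x) ` A \<subseteq> ring_of_integers K)}"

definition narrow_equiv :: "real set \<Rightarrow> (real set \<times> real set) set" where
  "narrow_equiv K = {(A, B). A \<in> fractional_ideals K \<and> B \<in> fractional_ideals K \<and>
     (\<exists>c\<in>K. c * galois_conj K c > 0 \<and> A = (\<lambda>x. c * x) ` B)}"

definition narrow_ideal_classes :: "real set \<Rightarrow> real set set set" where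
  "narrow_ideal_classes K = fractional_ideals K // narrow_equiv K"

definition additive_index :: "real set \<Rightarrow> real set \<Rightarrow> nat" where
  "additive_index A B = card ((\<lambda>x. (\<lambda>b. x + b) ` B) ` A)"

definition ideal_norm :: "real set \<Rightarrow> real set \<Rightarrow> real" where
  "ideal_norm K A =
     (let \<xi> = (SOME \<xi>::int. \<xi> \<noteq> 0 \<and> (\<lambda>x. of_int \<xi> * x) ` A \<subseteq> ring_of_integers K)
      in additive_index (ring_of_integers K) ((\<lambda>x. of_int \<xi> * x) ` A) / (of_int \<xi>)\<^sup>2)"

definition oriented_basis :: "real set \<Rightarrow> real set \<Rightarrow> real \<Rightarrow> real \<Rightarrow> bool" where
  "oriented_basis K A \<alpha> \<beta> \<longleftrightarrow>
     Z_basis A \<alpha> \<beta> \<and> galois_conj K \<alpha> * \<beta> - \<alpha> * galois_conj K \<beta> > 0"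

definition ideal_form ::
    "real set \<Rightarrow> real set \<Rightarrow> real \<Rightarrow> real \<Rightarrow> int \<Rightarrow> int \<Rightarrow> int \<Rightarrow> bool" where
  "ideal_form K A \<alpha> \<beta> a b c \<longleftrightarrow>
     (\<forall>X Y :: real.
        (X * \<alpha> + Y * \<beta>) * (X * galois_conj K \<alpha> + Y * galois_conj K \<beta>) / ideal_norm K A
        = of_int a * X\<^sup>2 + of_int b * X * Y + of_int c * Y\<^sup>2)"

definition SL2Z :: "(int^2^2) monoid" where
  "SL2Z = \<lparr>carrier = {A. det A = 1}, mult = (**), one = mat 1\<rparr>"

definition PSL2Z :: "(int^2^2) set monoid" where
  "PSL2Z = SL2Z Mod {mat 1, - mat 1}"

definition psl_class :: "int^2^2 \<Rightarrow> (int^2^2) set" where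
  "psl_class A = {mat 1, - mat 1} #>\<^bsub>SL2Z\<^esub> A"

definition S_psl :: "(int^2^2) set" where "S_psl = psl_class (mat2 0 (-1) 1 0)"
definition L_psl :: "(int^2^2) set" where "L_psl = psl_class (mat2 1 (-1) 1 0)"

text \<open>
  The minimality condition determines \<open>x\<close> only up to sign; as usual \<open>x\<close> is taken positive.
  (Replacing \<open>x\<close> by \<open>-x\<close> replaces the fundamental automorphism by its inverse
  in \<open>PSL2Z\<close>.)
\<close>

definition pell_fundamental :: "int \<Rightarrow> int \<Rightarrow> int \<Rightarrow> bool" where
  "pell_fundamental \<Delta> x z \<longleftrightarrow> x > 0 \<and> z > 0 \<and> x\<^sup>2 - \<Delta> * z\<^sup>2 = 4 \<and>
     (\<forall>x' z'. z' > 0 \<and> x'\<^sup>2 - \<Delta> * z'\<^sup>2 = 4 \<longrightarrow> z \<le> z')"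

text \<open>The divisions are exact: \<open>x\<^sup>2 - \<Delta> z\<^sup>2 = 4\<close> and \<open>\<Delta> = b\<^sup>2 - 4ac\<close>
  force \<open>x\<close> and \<open>z b\<close> to have the same parity.\<close>

definition fundamental_automorphism ::
    "int \<Rightarrow> int \<Rightarrow> int \<Rightarrow> int \<Rightarrow> int \<Rightarrow> (int^2^2) set" where
  "fundamental_automorphism a b c x z =
     psl_class (mat2 ((x - z * b) div 2) (- c * z) (a * z) ((x + z * b) div 2))"

primrec psl_word :: "(int \<times> int) list \<Rightarrow> (int^2^2) set" where
  "psl_word [] = \<one>\<^bsub>PSL2Z\<^esub>"
| "psl_word (p # ps) =
     (L_psl \<otimes>\<^bsub>PSL2Z\<^esub> S_psl) [^]\<^bsub>PSL2Z\<^esub> (fst p) \<otimes>\<^bsub>PSL2Z\<^esub>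
     ((L_psl [^]\<^bsub>PSL2Z\<^esub> (2::nat)) \<otimes>\<^bsub>PSL2Z\<^esub> S_psl) [^]\<^bsub>PSL2Z\<^esub> (snd p) \<otimes>\<^bsub>PSL2Z\<^esub>
     psl_word ps"

definition conjugate_in :: "('g, 'h) monoid_scheme \<Rightarrow> 'g \<Rightarrow> 'g \<Rightarrow> bool" where
  "conjugate_in G v w \<longleftrightarrow> (\<exists>g\<in>carrier G. w = g \<otimes>\<^bsub>G\<^esub> v \<otimes>\<^bsub>G\<^esub> inv\<^bsub>G\<^esub> g)"

text \<open>
  The tuples \<open>(m\<^sub>1, n\<^sub>1, \<dots>, m\<^sub>l, n\<^sub>l)\<close>, as lists of pairs, attached to a narrow
  ideal class \<open>C\<close> by way of any ideal in \<open>C\<close> and any oriented basis of it.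
\<close>

definition class_tuples :: "real set \<Rightarrow> real set set \<Rightarrow> (int \<times> int) list set" where
  "class_tuples K C = {t. t \<noteq> [] \<and> (\<forall>(m, n)\<in>set t. m \<ge> 1 \<and> n \<ge> 1) \<and>
     (\<exists>A\<in>C. \<exists>\<alpha> \<beta> a b c x z.
        oriented_basis K A \<alpha> \<beta> \<and> ideal_form K A \<alpha> \<beta> a b c \<and>
        pell_fundamental (field_discriminant K) x z \<and>
        conjugate_in PSL2Z (fundamental_automorphism a b c x z) (psl_word t))}"

end

theory Submission
  imports Defs "HOL-Analysis.Kronecker_Approximation_Theorem"
begin

text \<open>
  Up to sign, \<open>LS\<close> and \<open>L\<^sup>2S\<close> are the upper and the lower elementary matrix, so the word
  \<open>(LS)\<^sup>m (L\<^sup>2S)\<^sup>n\<close> is the class of \<open>M(m, n)\<close>, and the word of a tuple is the class of the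
  product matrix whose trace is the Lucas polynomial. The fundamental automorphism of an ideal has
  trace \<open>x\<^sub>o\<close>, and conjugation in \<open>PSL\<^sub>2(\<int>)\<close> preserves traces up to sign; hence the
  Lucas value \<open>T\<close> satisfies \<open>T\<^sup>2 - 4 = x\<^sub>o\<^sup>2 - 4 = z\<^sub>o\<^sup>2 \<Delta>\<close> for every tuple of every class.

  That a class has a tuple at all rests on three facts. The form of an ideal is integral of
  discriminant \<open>\<Delta>\<close>, because ideal norms are quotients of determinants of lattice bases. As
  \<open>\<Delta>\<close> is positive and not a square, Pell's equation is solvable and the fundamental
  automorphism is hyperbolic. Finally, a hyperbolic matrix of positive trace is conjugate to one with
  positive entries; such a matrix is a product of elementary matrices of both kinds, and after a
  cyclic rotation the product starts with an upper and ends with a lower one.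
\<close>

section \<open>Words in the modular group\<close>

lemma mat2_eq_iff [simp]:
  "mat2 a b c d = mat2 a' b' c' d' \<longleftrightarrow> a = a' \<and> b = b' \<and> c = c' \<and> d = d'"
  by (metis mat2_nth)

lemma mat2_cases:
  obtains a b c d where "A = mat2 a b c d"
proof
  show "A = mat2 (A $ 1 $ 1) (A $ 1 $ 2) (A $ 2 $ 1) (A $ 2 $ 2)"
    by (simp add: vec_eq_iff forall_2)
qed

lemma mat2_mult [simp]:
  fixes a :: "'a::comm_ring_1"
  shows "mat2 a b c d ** mat2 a' b' c' d' =
    mat2 (a * a' + b * c') (a * b' + b * d') (c * a' + d * c') (c * b' + d * d')"
  by (simp add: vec_eq_iff forall_2 matrix_matrix_mult_def sum_2)

lemma mat_1_eq_mat2: "mat 1 = mat2 1 0 0 (1 :: 'a::comm_ring_1)"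
  by (simp add: vec_eq_iff forall_2 mat_def)

lemma uminus_mat2 [simp]: "- mat2 a b c d = mat2 (- a) (- b) (- c) (- d :: 'a::comm_ring_1)"
  by (simp add: vec_eq_iff forall_2)

lemma det_mat2 [simp]: "det (mat2 a b c d) = a * d - b * (c :: 'a::comm_ring_1)"
  by (simp add: det_2)

lemma trace_mat2 [simp]: "trace (mat2 a b c d) = a + (d :: 'a::comm_ring_1)"
  by (simp add: trace_def sum_2)

lemma uminus_matrix_mult:
  fixes A B :: "int^2^2"
  shows "(- A) ** B = - (A ** B)" "A ** (- B) = - (A ** B)"
  by (cases A rule: mat2_cases, cases B rule: mat2_cases; simp)+

text \<open>The adjugate: on matrices of determinant one it is the inverse, and it is computed
  without division.\<close>

definition adj2 :: "int^2^2 \<Rightarrow> int^2^2" where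
  "adj2 A = mat2 (A $ 2 $ 2) (- A $ 1 $ 2) (- A $ 2 $ 1) (A $ 1 $ 1)"

lemma adj2_mat2 [simp]: "adj2 (mat2 a b c d) = mat2 d (- b) (- c) a"
  by (simp add: adj2_def)

lemma adj2_mult:
  assumes "det A = 1"
  shows "adj2 A ** A = mat 1" "A ** adj2 A = mat 1"
  using assms by (cases A rule: mat2_cases; simp add: mat_1_eq_mat2 algebra_simps)+

lemma det_adj2 [simp]: "det (adj2 A) = det A"
  by (cases A rule: mat2_cases) (simp add: algebra_simps)

lemma adj2_adj2 [simp]: "adj2 (adj2 A) = A"
  by (cases A rule: mat2_cases) simp

section \<open>The groups SL2 and PSL2 over the integers\<close>

lemma group_SL2Z: "group SL2Z"
proof (rule groupI)
  fix A assume "A \<in> carrier SL2Z"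
  then show "\<exists>B\<in>carrier SL2Z. B \<otimes>\<^bsub>SL2Z\<^esub> A = \<one>\<^bsub>SL2Z\<^esub>"
    by (intro bexI[of _ "adj2 A"]) (auto simp: SL2Z_def adj2_mult)
qed (auto simp: SL2Z_def det_mul matrix_mul_assoc)

lemma normal_center: "{mat 1, - mat 1} \<lhd> SL2Z"
proof (rule group.normal_invI[OF group_SL2Z])
  show "subgroup {mat 1, - mat 1} SL2Z"
  proof (rule group.subgroupI[OF group_SL2Z])
    fix A assume A: "A \<in> {mat 1, - mat 1 :: int^2^2}"
    have "inv\<^bsub>SL2Z\<^esub> A = A"
      by (rule group.inv_equality[OF group_SL2Z])
        (use A in \<open>auto simp: SL2Z_def mat_1_eq_mat2\<close>)
    with A show "inv\<^bsub>SL2Z\<^esub> A \<in> {mat 1, - mat 1}" by simp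
  qed (auto simp: SL2Z_def mat_1_eq_mat2)
next
  fix X H assume X: "X \<in> carrier SL2Z" and H: "H \<in> {mat 1, - mat 1 :: int^2^2}"
  interpret group SL2Z by (rule group_SL2Z)
  have Hc: "H \<in> carrier SL2Z" using H by (auto simp: SL2Z_def mat_1_eq_mat2)
  have "X \<otimes>\<^bsub>SL2Z\<^esub> H = H \<otimes>\<^bsub>SL2Z\<^esub> X"
    using H by (auto simp: SL2Z_def uminus_matrix_mult)
  then have "X \<otimes>\<^bsub>SL2Z\<^esub> H \<otimes>\<^bsub>SL2Z\<^esub> inv\<^bsub>SL2Z\<^esub> X = H"
    using X Hc by (simp add: m_assoc)
  then show "X \<otimes>\<^bsub>SL2Z\<^esub> H \<otimes>\<^bsub>SL2Z\<^esub> inv\<^bsub>SL2Z\<^esub> X \<in> {mat 1, - mat 1}"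
    using H by simp
qed

lemma group_PSL2Z: "group PSL2Z"
  unfolding PSL2Z_def by (rule normal.factorgroup_is_group[OF normal_center])

lemma psl_class_eq: "psl_class A = {A, - A}"
  by (auto simp: psl_class_def r_coset_def SL2Z_def uminus_matrix_mult)

lemma psl_class_eq_iff: "psl_class A = psl_class B \<longleftrightarrow> A = B \<or> A = - B"
  unfolding psl_class_eq by (auto simp: doubleton_eq_iff)

lemma carrier_PSL2Z: "carrier PSL2Z = psl_class ` {A. det A = 1}"
  by (auto simp: PSL2Z_def FactGroup_def RCOSETS_def psl_class_def SL2Z_def)

lemma psl_class_mult: "psl_class A \<otimes>\<^bsub>PSL2Z\<^esub> psl_class B = psl_class (A ** B)"
  by (auto simp: PSL2Z_def FactGroup_def set_mult_def psl_class_eq SL2Z_def uminus_matrix_mult)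

lemma one_PSL2Z: "\<one>\<^bsub>PSL2Z\<^esub> = psl_class (mat 1)"
  by (simp add: PSL2Z_def FactGroup_def psl_class_eq)

lemma inv_psl_class:
  assumes "det A = 1"
  shows "inv\<^bsub>PSL2Z\<^esub> psl_class A = psl_class (adj2 A)"
  by (rule group.inv_equality[OF group_PSL2Z])
    (use assms in \<open>auto simp: psl_class_mult one_PSL2Z adj2_mult carrier_PSL2Z\<close>)

text \<open>Lifting a conjugacy to integral matrices costs a sign, which is harmless later: only the
  square of the trace enters the equation.\<close>

lemma conjugate_in_psl_class:
  "conjugate_in PSL2Z (psl_class A) (psl_class B) \<longleftrightarrow>
    (\<exists>G. det G = 1 \<and> (B = G ** A ** adj2 G \<or> B = - (G ** A ** adj2 G)))"
  by (auto simp: conjugate_in_def carrier_PSL2Z inv_psl_class psl_class_mult psl_class_eq_iff)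

lemma LS_psl: "L_psl \<otimes>\<^bsub>PSL2Z\<^esub> S_psl = psl_class (mat2 1 1 0 1)"
  by (simp add: L_psl_def S_psl_def psl_class_mult psl_class_eq_iff)

lemma LLS_psl: "(L_psl [^]\<^bsub>PSL2Z\<^esub> (2::nat)) \<otimes>\<^bsub>PSL2Z\<^esub> S_psl = psl_class (mat2 1 0 1 1)"
  by (simp add: numeral_2_eq_2 nat_pow_def one_PSL2Z L_psl_def S_psl_def psl_class_mult
      psl_class_eq_iff mat_1_eq_mat2)

lemma nat_pow_upper:
  "psl_class (mat2 1 1 0 1) [^]\<^bsub>PSL2Z\<^esub> (n::nat) = psl_class (mat2 1 (int n) 0 1)"
  by (induction n) (simp_all add: nat_pow_def one_PSL2Z psl_class_mult mat_1_eq_mat2)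

lemma nat_pow_lower:
  "psl_class (mat2 1 0 1 1) [^]\<^bsub>PSL2Z\<^esub> (n::nat) = psl_class (mat2 1 0 (int n) 1)"
  by (induction n) (simp_all add: nat_pow_def one_PSL2Z psl_class_mult mat_1_eq_mat2 add.commute)

section \<open>Words and products of elementary matrices\<close>

abbreviation pos_tuple :: "(int \<times> int) list \<Rightarrow> bool" where
  "pos_tuple t \<equiv> \<forall>(m, n)\<in>set t. m \<ge> 1 \<and> n \<ge> 1"

text \<open>Positive exponents turn the integer powers into natural ones, and the powers
  \<open>m\<close> and \<open>n\<close> of the two elementary matrices multiply to
  \<open>lucas_matrix1 m n\<close>.\<close>

lemma psl_word_eq_psl_class:
  assumes "pos_tuple t"
  shows "psl_word t = psl_class (lucas_matrix t)"
  using assms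
proof (induction t)
  case Nil
  then show ?case by (simp add: one_PSL2Z)
next
  case (Cons p t)
  obtain m n where p: "p = (m, n)" by force
  with Cons.prems have mn: "m \<ge> 1" "n \<ge> 1" by auto
  have "psl_word (p # t) =
      psl_class (mat2 1 m 0 1) \<otimes>\<^bsub>PSL2Z\<^esub> psl_class (mat2 1 0 n 1) \<otimes>\<^bsub>PSL2Z\<^esub> psl_class (lucas_matrix t)"
    using Cons mn by (simp add: p LS_psl LLS_psl int_pow_def2 nat_pow_upper nat_pow_lower)
  then show ?case
    by (simp add: psl_class_mult p lucas_matrix1_def add.commute)
qed

text \<open>Words are spelled letter by letter, since Euclidean descent and cyclic rotation move
  single letters; \<open>word_mat_blocks\<close> collects the exponents afterwards.\<close>

primrec word_mat :: "bool list \<Rightarrow> int^2^2" where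
  "word_mat [] = mat 1"
| "word_mat (b # w) = (if b then mat2 1 1 0 1 else mat2 1 0 1 1) ** word_mat w"

lemma word_mat_append: "word_mat (u @ v) = word_mat u ** word_mat v"
  by (induction u) (simp_all add: matrix_mul_assoc)

lemma det_word_mat: "det (word_mat w) = 1"
  by (induction w) (auto simp: det_mul)

text \<open>A power of one elementary matrix is unipotent. Hence a word of larger trace contains
  both letters, as \<open>word_rotation\<close> requires.\<close>

lemma trace_word_mat_const:
  "set w \<subseteq> {b} \<Longrightarrow> trace (word_mat w) = 2"
proof -
  assume w: "set w \<subseteq> {b}"
  have "word_mat w = (if b then mat2 1 (int (length w)) 0 1 else mat2 1 0 (int (length w)) 1)"
    using w by (induction w) (auto simp: mat_1_eq_mat2)
  then show ?thesis by auto
qed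

text \<open>The Euclidean algorithm on the rows: determinant one makes one row dominate the other
  unless the matrix is the identity. Subtracting the smaller row splits off one letter and lowers
  the sum of the entries.\<close>

lemma nonneg_mat_is_word:
  assumes "a \<ge> 0" "b \<ge> 0" "c \<ge> 0" "d \<ge> 0" "a * d - b * c = 1"
  shows "\<exists>w. mat2 a b c d = word_mat w"
  using assms
proof (induction "nat (a + b + c + d)" arbitrary: a b c d rule: less_induct)
  case less
  \<comment> \<open>Determinant one makes \<open>a * d\<close> positive, so the subtracted row is
    nonzero and the descent is strict.\<close>
  have ad: "a > 0" "d > 0"
    using less.prems by (auto simp: less_le mult_nonneg_nonneg)
      (smt (verit) mult_nonneg_nonneg mult_zero_left mult_zero_right)+
  consider "a \<ge> c" "b \<ge> d" | "c \<ge> a" "d \<ge> b" | "a > c" "b < d" | "a < c" "b > d"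
    by linarith
  then show ?case
  proof cases
    case 1
    have "\<exists>w. mat2 (a - c) (b - d) c d = word_mat w"
      by (rule less.hyps) (use 1 less.prems ad in \<open>auto simp: algebra_simps\<close>)
    then obtain w where "mat2 (a - c) (b - d) c d = word_mat w" by blast
    then have "mat2 a b c d = word_mat (True # w)" by (simp flip: \<open>_ = word_mat w\<close>)
    then show ?thesis by blast
  next
    case 2
    have "\<exists>w. mat2 a b (c - a) (d - b) = word_mat w"
      by (rule less.hyps) (use 2 less.prems ad in \<open>auto simp: algebra_simps\<close>)
    then obtain w where "mat2 a b (c - a) (d - b) = word_mat w" by blast
    then have "mat2 a b c d = word_mat (False # w)" by (simp flip: \<open>_ = word_mat w\<close>)
    then show ?thesis by blast
  next
    case 3
    \<comment> \<open>Crossed inequalities leave no room: \<open>a * d\<close> is only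
      \<open>1 + b * c\<close>, so the off-diagonal entries vanish and the identity remains.\<close>
    have "(c + 1) * (b + 1) \<le> a * d" using 3 less.prems by (intro mult_mono) auto
    then have "c + b \<le> 0" using less.prems by (simp add: algebra_simps)
    then have "b = 0" "c = 0" using less.prems by auto
    then have "a = 1" "d = 1" using less.prems by (auto simp: zmult_eq_1_iff)
    with \<open>b = 0\<close> \<open>c = 0\<close> have "mat2 a b c d = word_mat []" by (simp add: mat_1_eq_mat2)
    then show ?thesis by blast
  next
    case 4
    have "a * d \<le> c * b" using 4 less.prems by (intro mult_mono) auto
    then show ?thesis using less.prems by (simp add: mult.commute)
  qed
qed

text \<open>The word of a tuple starts with an upper and ends with a lower letter; a cyclic
  rotation, hence a conjugation, arranges both.\<close>

lemma word_rotation: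
  assumes "True \<in> set w" "False \<in> set w"
  obtains u v v' where "w = u @ v" "v @ u = True # v' @ [False]"
proof -
  obtain u v where w: "w = u @ v" and v: "v \<noteq> []" "hd v"
  proof (cases "dropWhile Not w")
    case Nil
    then show ?thesis using assms by (auto simp: dropWhile_eq_Nil_conv)
  next
    case (Cons b v)
    then have "hd (dropWhile Not w)" using hd_dropWhile[of Not w] by auto
    with Cons show ?thesis using that[of "takeWhile Not w" "b # v"]
      by (metis list.distinct(1) takeWhile_dropWhile_id)
  qed
  have "False \<in> set (v @ u)" using assms w by auto
  \<comment> \<open>The letters \<open>d\<close> behind the last \<open>False\<close> are all
    \<open>True\<close>; moved to the front they keep an initial \<open>True\<close> and leave a
    final \<open>False\<close>.\<close>
  then obtain c d where cd: "v @ u = c @ False # d" "False \<notin> set d"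
    by (metis split_list_last)
  have hc: "c \<noteq> []" "hd c" using v cd(1) by (cases v; cases c; auto)+
  have "\<exists>c'. d @ c @ [False] = True # c' @ [False]"
    using hc cd(2) by (cases d; cases c; auto)
  then obtain c' where c': "d @ c @ [False] = True # c' @ [False]" by blast
  \<comment> \<open>Two successive rotations amount to one; its cut falls inside \<open>u\<close> or
    inside \<open>v\<close>.\<close>
  have "\<exists>u' v'. w = u' @ v' \<and> v' @ u' = d @ c @ [False]"
  proof -
    have "(c @ [False]) @ d = v @ u" using cd(1) by simp
    then consider us where "c @ [False] = v @ us" "us @ d = u" | us where "(c @ [False]) @ us = v" "d = us @ u"
      unfolding append_eq_append_conv2 by blast
    then show ?thesis
    proof cases
      case 1
      then show ?thesis using w by (intro exI[of _ us] exI[of _ "d @ v"]) auto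
    next
      case 2
      then show ?thesis using w by (intro exI[of _ "u @ c @ [False]"] exI[of _ us]) auto
    qed
  qed
  with c' that show thesis by metis
qed

text \<open>Built up from the right, each letter extends the open leading pair \<open>(m, n)\<close>
  or starts a new one. The value \<open>m = 0\<close> is allowed as long as the open pair has lower
  letters only; a leading \<open>True\<close> makes it positive.\<close>

lemma word_mat_blocks:
  assumes "w = w' @ [False]"
  shows "\<exists>m n t. (hd w \<longrightarrow> m \<ge> 1) \<and> m \<ge> 0 \<and> n \<ge> 1 \<and> pos_tuple t \<and>
    word_mat w = lucas_matrix1 m n ** lucas_matrix t"
  using assms
proof (induction w arbitrary: w')
  case (Cons b w)
  show ?case
  proof (cases w)
    case Nil
    then show ?thesis using Cons.prems
      by (intro exI[of _ 0] exI[of _ 1] exI[of _ "[]"]) (auto simp: lucas_matrix1_def)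
  next
    case (Cons b' w'')
    then have "w = tl w' @ [False]" using Cons.prems by (cases w') auto
    then obtain m n t where t: "m \<ge> 0" "n \<ge> 1" "pos_tuple t"
      "word_mat w = lucas_matrix1 m n ** lucas_matrix t"
      using Cons.IH by blast
    consider "b" | "\<not> b" "m = 0" | "\<not> b" "m \<ge> 1" using t(1) by linarith
    then show ?thesis
    proof cases
      case 1
      then show ?thesis using t
        by (intro exI[of _ "m + 1"] exI[of _ n] exI[of _ t])
          (auto simp: lucas_matrix1_def matrix_mul_assoc algebra_simps)
    next
      case 2
      then show ?thesis using t
        by (intro exI[of _ 0] exI[of _ "n + 1"] exI[of _ t])
          (auto simp: lucas_matrix1_def matrix_mul_assoc algebra_simps)
    next
      case 3
      \<comment> \<open>A lower letter in front of an upper one closes the pair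
        \<open>(m, n)\<close>, which moves into the list, and opens the pair
        \<open>(0, 1)\<close>.\<close>
      then show ?thesis using t
        by (intro exI[of _ 0] exI[of _ 1] exI[of _ "(m, n) # t"])
          (auto simp: lucas_matrix1_def matrix_mul_assoc algebra_simps)
    qed
  qed
qed simp

section \<open>Reduction of hyperbolic matrices\<close>

definition conj_SL2 :: "int^2^2 \<Rightarrow> int^2^2 \<Rightarrow> bool" where
  "conj_SL2 A B \<longleftrightarrow> (\<exists>G. det G = 1 \<and> B = G ** A ** adj2 G)"

lemma adj2_matrix_mult: "adj2 (A ** B) = adj2 B ** adj2 A"
  by (cases A rule: mat2_cases; cases B rule: mat2_cases) (simp add: algebra_simps)

lemma conj_SL2_trans:
  assumes "conj_SL2 A B" "conj_SL2 B C"
  shows "conj_SL2 A C"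
proof -
  obtain G H where "det G = 1" "B = G ** A ** adj2 G" "det H = 1" "C = H ** B ** adj2 H"
    using assms by (auto simp: conj_SL2_def)
  then have "det (H ** G) = 1 \<and> C = (H ** G) ** A ** adj2 (H ** G)"
    by (simp add: det_mul adj2_matrix_mult matrix_mul_assoc)
  then show ?thesis unfolding conj_SL2_def by blast
qed

lemma trace_conj_SL2: "conj_SL2 A B \<Longrightarrow> trace B = trace A"
proof -
  assume "conj_SL2 A B"
  then obtain G where G: "det G = 1" "B = G ** A ** adj2 G" by (auto simp: conj_SL2_def)
  have "trace B = trace (adj2 G ** (G ** A))" unfolding G(2) by (rule trace_mul_sym)
  also have "adj2 G ** (G ** A) = A" by (simp add: matrix_mul_assoc adj2_mult G)
  finally show ?thesis .
qed

lemma det_conj_SL2: "conj_SL2 A B \<Longrightarrow> det B = det A"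
  by (auto simp: conj_SL2_def det_mul)

text \<open>Conjugation by the inverse of \<open>A\<close> carries the front factor to the back, so
  rotating a word preserves its conjugacy class.\<close>

lemma conj_SL2_rotate:
  assumes "det A = 1"
  shows "conj_SL2 (A ** B) (B ** A)"
proof -
  have "B ** A = adj2 A ** (A ** B) ** adj2 (adj2 A)"
    unfolding adj2_adj2 matrix_mul_assoc adj2_mult(1)[OF assms] by simp
  then show ?thesis using assms unfolding conj_SL2_def by (intro exI[of _ "adj2 A"]) auto
qed

text \<open>Reduction theory of indefinite forms: as long as \<open>q * r < 0\<close>, a translation on the side
  of the smaller off-diagonal entry decreases \<open>\<bar>s - p\<bar>\<close>.\<close>

lemma conj_SL2_off_diagonal_pos:
  assumes "p * s - q * r = 1" "p + s \<ge> 3"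
  shows "\<exists>p' q' r' s'. conj_SL2 (mat2 p q r s) (mat2 p' q' r' s') \<and> q' * r' > 0"
  using assms
proof (induction "nat \<bar>s - p\<bar>" arbitrary: p q r s rule: less_induct)
  case less
  have refl: "conj_SL2 (mat2 p q r s) (mat2 p q r s)"
    unfolding conj_SL2_def by (rule exI[of _ "mat 1"]) (simp add: mat_1_eq_mat2)
  \<comment> \<open>The squared trace minus 4 is the discriminant of the matrix; for trace at least
    3 it is positive, which bounds \<open>- 4 * (q * r)\<close> by the square of
    \<open>s - p\<close>.\<close>
  have disc: "(s - p)\<^sup>2 = (p + s)\<^sup>2 - 4 - 4 * (q * r)"
    using less.prems(1) by (simp add: power2_eq_square algebra_simps)
  have "(3::int)\<^sup>2 \<le> (p + s)\<^sup>2" using less.prems(2) by (intro power_mono) auto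
  then have big: "(s - p)\<^sup>2 > - 4 * (q * r)" using disc by simp
  have step: ?case if "conj_SL2 (mat2 p q r s) (mat2 p' q' r' s')" "\<bar>s' - p'\<bar> < \<bar>s - p\<bar>"
    "p' * s' - q' * r' = 1" "p' + s' = p + s" for p' q' r' s'
  proof -
    have "\<exists>p'' q'' r'' s''. conj_SL2 (mat2 p' q' r' s') (mat2 p'' q'' r'' s'') \<and> q'' * r'' > 0"
      by (rule less.hyps) (use that less.prems in auto)
    then show ?thesis using conj_SL2_trans[OF that(1)] by blast
  qed
  have upper: "conj_SL2 (mat2 p q r s) (mat2 (p + e * r) (q + e * (s - p) - e * e * r) r (s - e * r))" for e
    unfolding conj_SL2_def by (rule exI[of _ "mat2 1 e 0 1"]) (simp add: algebra_simps)
  have lower: "conj_SL2 (mat2 p q r s) (mat2 (p - e * q) q (r - e * (s - p) - e * e * q) (s + e * q))" for e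
    unfolding conj_SL2_def by (rule exI[of _ "mat2 1 0 e 1"]) (simp add: algebra_simps)
  consider "q * r > 0" | "q * r = 0" | "q * r < 0" "\<bar>r\<bar> \<le> \<bar>q\<bar>" | "q * r < 0" "\<bar>q\<bar> \<le> \<bar>r\<bar>"
    by linarith
  then show ?case
  proof cases
    case 1
    with refl show ?thesis by blast
  next
    case 2
    \<comment> \<open>A triangular matrix of determinant one has trace 2 or -2, against the
      hypothesis.\<close>
    then have "p * s = 1" using less.prems by linarith
    then have "p = 1 \<and> s = 1 \<or> p = -1 \<and> s = -1" by (auto simp: zmult_eq_1_iff)
    with less.prems show ?thesis by auto
  next
    case 3
    \<comment> \<open>The square of the smaller entry \<open>r\<close> is at most
      \<open>- (q * r)\<close>, hence less than the square of \<open>s - p\<close>.\<close>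
    have "r \<noteq> 0" using 3 by auto
    have "r\<^sup>2 \<le> \<bar>q\<bar> * \<bar>r\<bar>"
      using mult_right_mono[OF 3(2), of "\<bar>r\<bar>"] by (simp add: power2_eq_square abs_mult_self_eq flip: abs_mult)
    also have "\<dots> = - (q * r)" using 3(1) by (simp flip: abs_mult)
    finally have "r\<^sup>2 < (s - p)\<^sup>2" using big 3(1) by linarith
    then have lt: "\<bar>r\<bar> < \<bar>s - p\<bar>" by (simp add: abs_le_square_iff flip: not_le)
    \<comment> \<open>This sign moves \<open>s - p\<close> towards zero by twice
      \<open>\<bar>r\<bar>\<close>; as \<open>\<bar>r\<bar>\<close> lies strictly between 0 and
      \<open>\<bar>s - p\<bar>\<close>, the absolute value drops even if the sign changes.\<close>
    define e where "e = sgn r * sgn (s - p)"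
    have e: "\<bar>s - p - 2 * e * r\<bar> < \<bar>s - p\<bar>"
      using lt \<open>r \<noteq> 0\<close> unfolding e_def
      by (cases "r > 0"; cases "s - p > 0") (simp_all add: sgn_if)
    show ?thesis
      by (rule step[OF upper[of e]]) (use e less.prems in \<open>auto simp: algebra_simps\<close>)
  next
    case 4
    have "q \<noteq> 0" using 4 by auto
    have "q\<^sup>2 \<le> \<bar>q\<bar> * \<bar>r\<bar>"
      using mult_right_mono[OF 4(2), of "\<bar>q\<bar>"] by (simp add: power2_eq_square abs_mult_self_eq mult.commute flip: abs_mult)
    also have "\<dots> = - (q * r)" using 4(1) by (simp flip: abs_mult)
    finally have "q\<^sup>2 < (s - p)\<^sup>2" using big 4(1) by linarith
    then have lt: "\<bar>q\<bar> < \<bar>s - p\<bar>" by (simp add: abs_le_square_iff flip: not_le)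
    define e where "e = - sgn q * sgn (s - p)"
    have e: "\<bar>s - p + 2 * e * q\<bar> < \<bar>s - p\<bar>"
      using lt \<open>q \<noteq> 0\<close> unfolding e_def
      by (cases "q > 0"; cases "s - p > 0") (simp_all add: sgn_if)
    show ?thesis
      by (rule step[OF lower[of e]]) (use e less.prems in \<open>auto simp: algebra_simps\<close>)
  qed
qed

text \<open>A positive off-diagonal product makes the diagonal product positive by determinant one,
  and positive trace makes both diagonal entries positive. If the off-diagonal entries are negative,
  conjugation by the matrix of \<open>S_psl\<close> flips their signs.\<close>

lemma conj_SL2_word:
  assumes "det A = 1" "trace A \<ge> 3"
  shows "\<exists>w. conj_SL2 A (word_mat w)"
proof -
  obtain p q r s where A: "A = mat2 p q r s" by (cases A rule: mat2_cases)
  obtain p' q' r' s' where c: "conj_SL2 A (mat2 p' q' r' s')" and pos: "q' * r' > 0"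
    using conj_SL2_off_diagonal_pos[of p s q r] assms by (auto simp: A)
  then have det: "p' * s' - q' * r' = 1"
    using assms(1) det_conj_SL2[OF c] by simp
  have tr: "p' + s' \<ge> 3" using trace_conj_SL2[OF c] assms(2) by simp
  have "p' * s' > 0" using det pos by linarith
  then have ps: "p' > 0" "s' > 0" using tr by (auto simp: zero_less_mult_iff)
  show ?thesis
  proof (cases "q' > 0")
    case True
    then have "r' > 0" using pos by (simp add: zero_less_mult_iff)
    then show ?thesis using nonneg_mat_is_word[of p' q' r' s'] True ps det c by auto
  next
    case False
    then have "q' < 0" "r' < 0" using pos by (auto simp: zero_less_mult_iff)
    moreover have "conj_SL2 (mat2 p' q' r' s') (mat2 s' (- r') (- q') p')"
      unfolding conj_SL2_def by (rule exI[of _ "mat2 0 (-1) 1 0"]) simp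
    ultimately show ?thesis
      using nonneg_mat_is_word[of s' "- r'" "- q'" p'] ps det conj_SL2_trans[OF c]
      by (fastforce simp: mult.commute)
  qed
qed

theorem conj_SL2_lucas_matrix:
  assumes "det A = 1" "trace A \<ge> 3"
  shows "\<exists>t. t \<noteq> [] \<and> pos_tuple t \<and> conj_SL2 A (lucas_matrix t)"
proof -
  obtain w where w: "conj_SL2 A (word_mat w)" using conj_SL2_word assms by blast
  have tr: "trace (word_mat w) \<ge> 3" using trace_conj_SL2[OF w] assms by simp
  have "b \<in> set w" for b
  proof (rule ccontr)
    assume "b \<notin> set w"
    then have "set w \<subseteq> {\<not> b}" by (auto; metis (full_types))
    from trace_word_mat_const[OF this] tr show False by simp
  qed
  then obtain u v v' where uv: "w = u @ v" "v @ u = True # v' @ [False]"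
    using word_rotation[of w] by metis
  obtain m n t where t: "m \<ge> 1" "n \<ge> 1" "pos_tuple t"
    "word_mat (v @ u) = lucas_matrix1 m n ** lucas_matrix t"
    using word_mat_blocks[of "v @ u" "True # v'"] uv(2) by auto
  have "conj_SL2 (word_mat w) (word_mat (v @ u))"
    by (simp add: uv(1) word_mat_append conj_SL2_rotate det_word_mat)
  with w have "conj_SL2 A (lucas_matrix ((m, n) # t))"
    using conj_SL2_trans t(4) by simp
  with t show ?thesis by (intro exI[of _ "(m, n) # t"]) auto
qed

section \<open>Pell's equation\<close>

text \<open>Dirichlet's argument: good rational approximations of the root give infinitely many
  pairs of bounded norm. Two distinct ones of equal norm \<open>n\<close> that are congruent modulo
  \<open>n\<close> have a nontrivial unit as quotient.\<close>

lemma pell_solution_exists: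
  fixes D :: int
  assumes irr: "sqrt (of_int D) \<notin> \<rat>" and D: "D > 0"
  shows "\<exists>x z. z > 0 \<and> x\<^sup>2 - D * z\<^sup>2 = 1"
proof -
  define \<theta> where "\<theta> = sqrt (of_int D)"
  have \<theta>: "\<theta> > 0" "\<theta>\<^sup>2 = of_int D" using D by (auto simp: \<theta>_def)
  define nm :: "int \<times> int \<Rightarrow> int" where "nm = (\<lambda>(h, k). h\<^sup>2 - D * k\<^sup>2)"
  have inf: "infinite (approx_set \<theta>)"
    using irr rational_iff_finite_approx_set by (auto simp: \<theta>_def)
  have pos: "snd p > 0" if "p \<in> approx_set \<theta>" for p
    using that by (auto simp: approx_set_def)
  \<comment> \<open>Up to sign the norm factors into \<open>of_int k * \<theta> - of_int h\<close>,
    of size at most \<open>1 / of_int k\<close>, and a conjugate factor of size at most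
    \<open>of_int k * (2 * \<theta> + 1)\<close>.\<close>
  have bound: "\<bar>real_of_int (nm p)\<bar> \<le> 2 * \<theta> + 1" if "p \<in> approx_set \<theta>" for p
  proof -
    obtain h k where p: "p = (h, k)" "k > 0" "\<bar>\<theta> - of_int h / of_int k\<bar> < 1 / (of_int k)\<^sup>2"
      using \<open>p \<in> approx_set \<theta>\<close> by (auto simp: approx_set_def)
    have k1: "real_of_int k \<ge> 1" using p(2) by simp
    have "\<bar>of_int k * \<theta> - of_int h\<bar> = of_int k * \<bar>\<theta> - of_int h / of_int k\<bar>"
    proof -
      have "of_int k * \<theta> - of_int h = of_int k * (\<theta> - of_int h / of_int k)"
        using k1 by (simp add: right_diff_distrib)
      then show ?thesis using k1 by (simp add: abs_mult)
    qed
    also have "\<dots> \<le> of_int k * (1 / (of_int k)\<^sup>2)"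
      using p(3) k1 by (intro mult_left_mono) auto
    also have "\<dots> = 1 / of_int k" using k1 by (simp add: power2_eq_square)
    finally have d: "\<bar>of_int k * \<theta> - of_int h\<bar> \<le> 1 / of_int k" .
    also have "\<dots> \<le> 1" using k1 by simp
    finally have "\<bar>of_int k * \<theta> + of_int h\<bar> \<le> 2 * (of_int k * \<theta>) + 1"
      using mult_pos_pos[of "of_int k" \<theta>] k1 \<theta>(1) by linarith
    also have "\<dots> \<le> of_int k * (2 * \<theta> + 1)" using k1 by (simp add: algebra_simps)
    finally have s: "\<bar>of_int k * \<theta> + of_int h\<bar> \<le> of_int k * (2 * \<theta> + 1)" .
    have "real_of_int (nm p) = - ((of_int k * \<theta> - of_int h) * (of_int k * \<theta> + of_int h))"
      using \<theta>(2) by (simp add: nm_def p algebra_simps power2_eq_square)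
    then have "\<bar>real_of_int (nm p)\<bar> = \<bar>of_int k * \<theta> - of_int h\<bar> * \<bar>of_int k * \<theta> + of_int h\<bar>"
      by (simp add: abs_mult)
    also have "\<dots> \<le> 1 / of_int k * (of_int k * (2 * \<theta> + 1))"
      using d s k1 by (intro mult_mono) auto
    also have "\<dots> = 2 * \<theta> + 1" using k1 by simp
    finally show ?thesis .
  qed
  define M where "M = \<lceil>2 * \<theta> + 1\<rceil>"
  have "nm ` approx_set \<theta> \<subseteq> {- M..M}"
  proof (clarify, goal_cases)
    case (1 a b)
    then show ?case using bound[OF 1] unfolding M_def atLeastAtMost_iff by linarith
  qed
  then have "finite (nm ` approx_set \<theta>)" using finite_subset by blast
  from pigeonhole_infinite[OF inf this] obtain p0
    where inf1: "infinite {p \<in> approx_set \<theta>. nm p = nm p0}" by blast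
  define n where "n = nm p0"
  define A where "A = {p \<in> approx_set \<theta>. nm p = n}"
  have infA: "infinite A" using inf1 by (simp add: A_def n_def)
  then obtain q0 where q0: "q0 \<in> A" by (metis all_not_in_conv finite.emptyI)
  \<comment> \<open>Norm zero would make \<open>\<theta>\<close> rational.\<close>
  have n0: "n \<noteq> 0"
  proof
    assume "n = 0"
    obtain h k where hk: "q0 = (h, k)" by force
    then have k: "k > 0" and "h\<^sup>2 = D * k\<^sup>2"
      using q0 pos[of q0] \<open>n = 0\<close> by (auto simp: A_def nm_def)
    then have "(\<theta> * of_int k)\<^sup>2 = (of_int h)\<^sup>2"
      by (simp add: power_mult_distrib \<theta> flip: of_int_power of_int_mult)
    then have "\<theta> * of_int k = \<bar>of_int h\<bar>"
      using k \<theta>(1) by (metis abs_of_nonneg less_eq_real_def mult_nonneg_nonneg of_int_0_le_iff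
          order_less_imp_le power2_eq_iff_nonneg abs_ge_zero power2_abs)
    then have "\<theta> = of_int \<bar>h\<bar> / of_int k" using k by (simp add: field_simps)
    then show False using irr by (auto simp: \<theta>_def)
  qed
  define g where "g = (\<lambda>(h, k). (h mod n, k mod n) :: int \<times> int)"
  have "finite (g ` A)"
  proof (rule finite_subset)
    show "g ` A \<subseteq> {-\<bar>n\<bar>..\<bar>n\<bar>} \<times> {-\<bar>n\<bar>..\<bar>n\<bar>}"
    proof -
      have "h mod n \<in> {-\<bar>n\<bar>..\<bar>n\<bar>}" for h
        using abs_mod_less[OF n0, of h] by auto
      then show ?thesis by (auto simp: g_def)
    qed
  qed auto
  from pigeonhole_infinite[OF infA this] obtain p1
    where p1: "p1 \<in> A" and inf2: "infinite {p \<in> A. g p = g p1}" by blast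
  from inf2 have "\<not> {p \<in> A. g p = g p1} \<subseteq> {p1}" using finite_subset by blast
  then obtain p2 where p2: "p2 \<in> A" "g p2 = g p1" "p2 \<noteq> p1" by blast
  obtain h k h' k' where hk: "p1 = (h, k)" "p2 = (h', k')" by force
  have n: "h\<^sup>2 - D * k\<^sup>2 = n" "h'\<^sup>2 - D * k'\<^sup>2 = n" "k > 0" "k' > 0"
    using p1 p2 pos[of p1] pos[of p2] by (auto simp: A_def hk nm_def)
  have "n dvd h' - h" "n dvd k' - k"
    using p2(2) by (auto simp: g_def hk mod_eq_dvd_iff)
  then obtain u v where uv: "h' = h + n * u" "k' = k + n * v"
    by (auto simp: dvd_def algebra_simps)
  \<comment> \<open>These are the coordinates of the quotient of \<open>h' + k' * \<theta>\<close>
    by \<open>h + k * \<theta>\<close>, with the division by \<open>n\<close> already carried out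
    through the congruences.\<close>
  define x where "x = 1 + h * u - D * k * v"
  define z where "z = h * v - u * k"
  have nx: "n * x = h * h' - D * k * k'" and nz: "n * z = h * k' - h' * k"
    using n(1) by (auto simp: x_def z_def uv algebra_simps power2_eq_square)
  have "n\<^sup>2 * (x\<^sup>2 - D * z\<^sup>2) = (n * x)\<^sup>2 - D * (n * z)\<^sup>2"
    by (simp add: algebra_simps power2_eq_square)
  also have "\<dots> = (h\<^sup>2 - D * k\<^sup>2) * (h'\<^sup>2 - D * k'\<^sup>2)"
    unfolding nx nz by (simp add: algebra_simps power2_eq_square)
  also have "\<dots> = n\<^sup>2 * 1" using n by (simp add: power2_eq_square)
  finally have eq: "x\<^sup>2 - D * z\<^sup>2 = 1" using n0 by simp
  \<comment> \<open>Otherwise the two pairs are proportional and, having equal norm and positive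
    second entries, equal.\<close>
  have "z \<noteq> 0"
  proof
    assume "z = 0"
    then have e: "h * k' = h' * k" using nz by simp
    have "k'\<^sup>2 * n - k\<^sup>2 * n = (h * k')\<^sup>2 - (h' * k)\<^sup>2"
      by (subst (1) n(1)[symmetric], subst (1) n(2)[symmetric]) (simp add: algebra_simps power2_eq_square)
    then have "k'\<^sup>2 = k\<^sup>2" using n0 e by (simp flip: left_diff_distrib)
    then have "k' = k" using n by (simp add: power2_eq_iff)
    with e n have "h = h'" by simp
    with \<open>k' = k\<close> p2(3) hk show False by simp
  qed
  then have "\<bar>z\<bar> > 0" "x\<^sup>2 - D * \<bar>z\<bar>\<^sup>2 = 1" using eq by auto
  then show ?thesis by blast
qed

text \<open>Doubling a solution with right-hand side 1 gives one with right-hand side 4, so a least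
  positive second component exists. Its first component is nonzero, and passing to the absolute
  value makes it positive.\<close>

lemma pell_fundamental_exists:
  fixes D :: int
  assumes "sqrt (of_int D) \<notin> \<rat>" "D > 0"
  shows "\<exists>x z. pell_fundamental D x z"
proof -
  obtain x z where xz: "z > 0" "x\<^sup>2 - D * z\<^sup>2 = 1" using pell_solution_exists assms by blast
  define P where "P = (\<lambda>m::nat. m > 0 \<and> (\<exists>x. x\<^sup>2 - D * (int m)\<^sup>2 = 4))"
  have "(2 * x)\<^sup>2 - D * (2 * z)\<^sup>2 = 4" using xz by (simp add: power2_eq_square algebra_simps)
  then have "P (nat (2 * z))"
    unfolding P_def using xz(1) by (intro conjI exI[of _ "2 * x"]) auto
  then have "P (LEAST m. P m)" by (rule LeastI)
  then obtain m x' where m: "m = (LEAST m. P m)" "m > 0" "x'\<^sup>2 - D * (int m)\<^sup>2 = 4"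
    by (auto simp: P_def)
  have "x' \<noteq> 0" using m(3) assms(2) by auto (smt (verit) mult_nonneg_nonneg zero_le_power2)
  moreover have "int m \<le> z'" if "z' > 0" "x''\<^sup>2 - D * z'\<^sup>2 = 4" for x'' z'
  proof -
    have "P (nat z')" using that by (auto simp: P_def)
    then have "m \<le> nat z'" unfolding m(1) by (rule Least_le)
    then show ?thesis using that by simp
  qed
  ultimately have "pell_fundamental D \<bar>x'\<bar> (int m)"
    using m by (auto simp: pell_fundamental_def)
  then show ?thesis by blast
qed

section \<open>Quadratic algebraic integers\<close>

lemma poly_of_int_smult:
  fixes x :: "'a::comm_ring_1"
  shows "poly (map_poly of_int (smult c p)) x = of_int c * poly (map_poly of_int p) x"
  by (induction p) (simp_all add: map_poly_pCons algebra_simps)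

lemma poly_of_int_add:
  fixes x :: "'a::comm_ring_1"
  shows "poly (map_poly of_int (p + q)) x = poly (map_poly of_int p) x + poly (map_poly of_int q) x"
  by (induction p q rule: poly_induct2) (simp_all add: map_poly_pCons algebra_simps)

lemma poly_of_int_mult:
  fixes x :: "'a::comm_ring_1"
  shows "poly (map_poly of_int (p * q)) x = poly (map_poly of_int p) x * poly (map_poly of_int q) x"
  by (induction p)
    (simp_all add: map_poly_pCons poly_of_int_add poly_of_int_smult algebra_simps)

lemma monic_content:
  fixes p :: "int poly"
  assumes "lead_coeff p = 1"
  shows "Polynomial.content p = 1"
  by (metis assms content_dvd_coeff is_unit_content_iff)

text \<open>By pseudo-division and Gauss's lemma, \<open>q\<close> divides \<open>p\<close> over the integers.\<close>

lemma primitive_quadratic_lead_unit: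
  fixes x :: real and p q :: "int poly"
  assumes "lead_coeff p = 1" "poly (map_poly of_int p) x = 0" "x \<notin> \<rat>"
    and q: "Polynomial.content q = 1" "degree q = 2" "poly (map_poly of_int q) x = 0"
  shows "is_unit (lead_coeff q)"
proof -
  have q0: "q \<noteq> 0" using q by auto
  obtain s r where sr: "pseudo_divmod p q = (s, r)" by force
  define w where "w = lead_coeff q ^ (Suc (degree p) - degree q)"
  have w0: "w \<noteq> 0" using q0 by (simp add: w_def)
  have eq: "smult w p = q * s + r" and deg: "r = 0 \<or> degree r < degree q"
    using pseudo_divmod[OF q0 sr] by (auto simp: w_def)
  \<comment> \<open>A remainder of degree at most 1 that vanishes at an irrational number is
    zero.\<close>
  have "degree r \<le> 1" using deg q(2) by auto
  then have "r = [:coeff r 0, coeff r 1:]"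
    by (intro poly_eqI) (auto simp: coeff_pCons coeff_eq_0 split: nat.splits)
  then obtain c d where r: "r = [:c, d:]" by blast
  have "poly (map_poly of_int (smult w p)) x = poly (map_poly of_int (q * s + r)) x"
    by (simp add: eq)
  then have "of_int c + of_int d * x = 0"
    using assms by (simp add: poly_of_int_add poly_of_int_mult poly_of_int_smult r map_poly_pCons mult.commute)
  moreover have "d = 0"
  proof (rule ccontr)
    assume "d \<noteq> 0"
    then have "x = - of_int c / of_int d"
      using \<open>of_int c + of_int d * x = 0\<close> by (simp add: field_simps)
    then show False using \<open>x \<notin> \<rat>\<close> by auto
  qed
  ultimately have "r = 0" using r by simp
  with eq have eq: "smult w p = q * s" by simp
  \<comment> \<open>As \<open>p\<close> and \<open>q\<close> are primitive and contents multiply,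
    the pseudo-division factor \<open>w\<close> sits entirely in \<open>s\<close> and
    cancels.\<close>
  have "Polynomial.content s = \<bar>w\<bar>"
    using arg_cong[OF eq, of Polynomial.content] q monic_content[OF assms(1)] by (simp add: content_mult)
  then obtain s' where s': "s = smult \<bar>w\<bar> s'" by (metis content_times_primitive_part)
  have "w * 1 = lead_coeff (smult w p)" using assms(1) by simp
  also have "\<dots> = w * (sgn w * lead_coeff q * lead_coeff s')"
    unfolding eq s' by (simp add: lead_coeff_mult abs_sgn[of w] )
  finally have "1 = lead_coeff q * (sgn w * lead_coeff s')"
    using w0 by (metis mult.assoc mult.commute mult_cancel_left)
  then show ?thesis by (metis dvdI)
qed

text \<open>The primitive integral multiple of the quadratic polynomial of \<open>x\<close> has
  leading coefficient 1 or -1, so up to sign its other coefficients are already \<open>t\<close> and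
  \<open>n\<close>.\<close>

lemma algebraic_int_quadratic:
  fixes x t n :: real
  assumes "algebraic_int x" "x \<notin> \<rat>" "t \<in> \<rat>" "n \<in> \<rat>" and eq: "x * x = t * x - n"
  shows "t \<in> \<int>" "n \<in> \<int>"
proof -
  obtain p where p: "lead_coeff p = 1" "poly (map_poly of_int p) x = 0"
    using assms(1) unfolding algebraic_int_altdef_ipoly by blast
  obtain a b where t: "t = of_int a / of_int b" "b > 0" by (rule Rats_cases'[OF assms(3)])
  obtain c d where n: "n = of_int c / of_int d" "d > 0" by (rule Rats_cases'[OF assms(4)])
  \<comment> \<open>This is X^2 - t X + n multiplied by the common denominator
    \<open>b * d\<close>.\<close>
  define f where "f = [:c * b, - (a * d), b * d:]"
  define q where "q = primitive_part f"
  define g where "g = Polynomial.content f"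
  have f0: "f \<noteq> 0" and degf: "degree f = 2" using t n by (auto simp: f_def)
  have g0: "g \<noteq> 0" using f0 by (simp add: g_def)
  have fq: "f = smult g q" by (simp add: g_def q_def)
  have "poly (map_poly of_int f) x = of_int (b * d) * (n - t * x + x * x)"
    using t n by (simp add: f_def map_poly_pCons field_simps)
  then have "poly (map_poly of_int q) x = 0"
    using eq g0 by (simp add: fq poly_of_int_smult)
  moreover have "Polynomial.content q = 1" "degree q = 2" using f0 degf by (simp_all add: q_def)
  ultimately have "is_unit (lead_coeff q)" using primitive_quadratic_lead_unit p assms(2) by blast
  then have w: "coeff q 2 = 1 \<or> coeff q 2 = -1" using \<open>degree q = 2\<close> by (simp add: zdvd1_eq abs_eq_iff) linarith
  have c: "c * b = g * coeff q 0" "- (a * d) = g * coeff q 1" "b * d = g * coeff q 2"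
    using arg_cong[OF fq, of "\<lambda>p. coeff p 0"] arg_cong[OF fq, of "\<lambda>p. coeff p 1"]
      arg_cong[OF fq, of "\<lambda>p. coeff p 2"] by (simp_all add: f_def numeral_2_eq_2)
  have "a * coeff q 2 = - coeff q 1 * b"
  proof -
    have "g * d * (a * coeff q 2) = (a * d) * (b * d)" unfolding c(3) by (simp add: algebra_simps)
    also have "\<dots> = - (g * coeff q 1) * (b * d)" unfolding c(2)[symmetric] by simp
    finally have "g * d * (a * coeff q 2) = g * d * (- coeff q 1 * b)" by (simp add: algebra_simps)
    moreover have "g * d \<noteq> 0" using g0 n by simp
    ultimately show ?thesis by (metis mult_left_cancel)
  qed
  then have "t * of_int (coeff q 2) = of_int (- coeff q 1)"
  proof -
    have "real_of_int a * of_int (coeff q 2) = - of_int (coeff q 1) * of_int b"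
      using \<open>a * coeff q 2 = _\<close> by (metis of_int_minus of_int_mult)
    then show ?thesis using t(2) unfolding t(1) by (simp add: field_simps)
  qed
  then show "t \<in> \<int>" using w by (metis Ints_minus Ints_of_int minus_minus mult.right_neutral mult_minus_right of_int_1 of_int_minus)
  have "c * coeff q 2 = coeff q 0 * d"
  proof -
    have "g * b * (c * coeff q 2) = g * b * (coeff q 0 * d)"
      using c(1,3) by (metis mult.assoc mult.commute)
    then show ?thesis using g0 t by simp
  qed
  then have "n * of_int (coeff q 2) = of_int (coeff q 0)"
  proof -
    have "real_of_int c * of_int (coeff q 2) = of_int (coeff q 0) * of_int d"
      using \<open>c * coeff q 2 = _\<close> by (metis of_int_mult)
    then show ?thesis using n(2) unfolding n(1) by (simp add: field_simps)
  qed
  then show "n \<in> \<int>" using w by (metis Ints_minus Ints_of_int minus_minus mult.right_neutral mult_minus_right of_int_1 of_int_minus)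
qed

lemma algebraic_int_if_quadratic:
  fixes x :: real
  assumes "t \<in> \<int>" "n \<in> \<int>" "x * x = t * x - n"
  shows "algebraic_int x"
proof (rule algebraic_int.intros)
  show "lead_coeff [:n, - t, 1:] = 1" by simp
  show "\<forall>i. coeff [:n, - t, 1:] i \<in> \<int>"
    using assms by (auto simp: coeff_pCons split: nat.splits)
  show "poly [:n, - t, 1:] x = 0" using assms by (simp add: algebra_simps)
qed

section \<open>Lattices of rank two\<close>

text \<open>Hermite normal form: \<open>r\<close> is the least positive second coordinate in
  \<open>H\<close>, and \<open>p\<close> the least positive first coordinate among elements with
  second coordinate 0. The multiples by \<open>P\<close> ensure that both exist.\<close>

lemma sublattice_hermite_basis:
  fixes H :: "(int \<times> int) set"
  assumes diff: "\<And>a b c d. (a, b) \<in> H \<Longrightarrow> (c, d) \<in> H \<Longrightarrow> (a - c, b - d) \<in> H"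
    and P: "P > 0" "(P, 0) \<in> H" "(0, P) \<in> H"
  obtains p q r where "p > 0" "r > 0" "H = {(m * p + n * q, n * r) | m n. True}"
proof -
  have zero: "(0, 0) \<in> H" using diff[OF P(2) P(2)] by simp
  have neg: "(- a, - b) \<in> H" if "(a, b) \<in> H" for a b using diff[OF zero that] by simp
  have add: "(a + c, b + d) \<in> H" if "(a, b) \<in> H" "(c, d) \<in> H" for a b c d
    using diff[OF that(1) neg[OF that(2)]] by simp
  have nat_mult: "(int k * a, int k * b) \<in> H" if "(a, b) \<in> H" for a b k
  proof (induction k)
    case (Suc k)
    show ?case using add[OF that Suc.IH] by (simp add: algebra_simps)
  qed (simp add: zero)
  have int_mult: "(k * a, k * b) \<in> H" if "(a, b) \<in> H" for a b k
    using nat_mult[OF that, of "nat k"] nat_mult[OF neg[OF that], of "nat (- k)"] by (cases "k \<ge> 0") auto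
  define A where "A = (\<lambda>k. k > 0 \<and> (int k, 0) \<in> H)"
  define B where "B = (\<lambda>k. k > 0 \<and> (\<exists>a. (a, int k) \<in> H))"
  have "A (nat P)" "B (nat P)" using P by (auto simp: A_def B_def)
  then have L: "A (LEAST k. A k)" "B (LEAST k. B k)" by (auto intro: LeastI)
  define p where "p = int (LEAST k. A k)"
  define r where "r = int (LEAST k. B k)"
  have p: "p > 0" "(p, 0) \<in> H" using L(1) by (auto simp: p_def A_def)
  obtain q where r: "r > 0" "(q, r) \<in> H" using L(2) by (auto simp: r_def B_def)
  have pmin: "p \<le> k" if "k > 0" "(k, 0) \<in> H" for k
    using Least_le[of A "nat k"] that by (simp add: A_def p_def)
  have rmin: "r \<le> k" if "k > 0" "(a, k) \<in> H" for a k
  proof -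
    have "B (nat k)" using that by (auto simp: B_def)
    then have "(LEAST k. B k) \<le> nat k" by (rule Least_le)
    then show ?thesis using that by (simp add: r_def)
  qed
  have "H = {(m * p + n * q, n * r) | m n. True}"
  proof (intro equalityI subsetI)
    fix z assume "z \<in> H"
    then obtain a b where z: "z = (a, b)" "(a, b) \<in> H" by (cases z) auto
    \<comment> \<open>Division with remainder, first in the second and then in the first coordinate;
      minimality kills both remainders.\<close>
    define n where "n = b div r"
    have "(a - n * q, b - n * r) \<in> H" using diff[OF z(2) int_mult[OF r(2)]] .
    moreover have "b - n * r = b mod r" by (simp add: n_def minus_div_mult_eq_mod)
    moreover have "0 \<le> b mod r" "b mod r < r" using r by auto
    ultimately have b: "b = n * r" and H: "(a - n * q, 0) \<in> H"
      using rmin by (force simp: le_less)+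
    define m where "m = (a - n * q) div p"
    have "(a - n * q - m * p, 0) \<in> H" using diff[OF H int_mult[OF p(2), of m]] by simp
    moreover have "a - n * q - m * p = (a - n * q) mod p" by (simp add: m_def minus_div_mult_eq_mod)
    moreover have "0 \<le> (a - n * q) mod p" "(a - n * q) mod p < p" using p by auto
    ultimately have "a - n * q = m * p" using pmin by (force simp: le_less)
    then have "z = (m * p + n * q, n * r)" by (simp add: z b)
    then show "z \<in> {(m * p + n * q, n * r) | m n. True}" by blast
  next
    fix z assume "z \<in> {(m * p + n * q, n * r) | m n. True}"
    then obtain m n where "z = (m * p + n * q, n * r)" by blast
    then show "z \<in> H" using add[OF int_mult[OF p(2), of m] int_mult[OF r(2), of n]] by simp
  qed
  with p r that show thesis by blast
qed

text \<open>Thanks to the triangular basis, the points of a \<open>p\<close> by \<open>r\<close>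
  rectangle represent each coset exactly once: the second coordinate is reduced first, since doing
  so shifts the first by multiples of \<open>q\<close>.\<close>

lemma additive_index_hermite:
  fixes e\<^sub>1 e\<^sub>2 :: real and p q r :: int
  assumes indep: "\<And>m n :: int. of_int m * e\<^sub>1 + of_int n * e\<^sub>2 = 0 \<Longrightarrow> m = 0 \<and> n = 0"
    and pr: "p > 0" "r > 0"
    and A: "A = {of_int m * e\<^sub>1 + of_int n * e\<^sub>2 | m n. True}"
    and B: "B = {of_int (m * p + n * q) * e\<^sub>1 + of_int (n * r) * e\<^sub>2 | m n. True}"
  shows "additive_index A B = nat (p * r)"
proof -
  have inj: "m = m' \<and> n = n'" if "of_int m * e\<^sub>1 + of_int n * e\<^sub>2 = of_int m' * e\<^sub>1 + of_int n' * e\<^sub>2"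
    for m n m' n'
    using indep[of "m - m'" "n - n'"] that by (simp add: algebra_simps)
  have mem: "of_int a * e\<^sub>1 + of_int b * e\<^sub>2 \<in> B \<longleftrightarrow> (\<exists>m n. a = m * p + n * q \<and> b = n * r)" for a b
    unfolding B using inj by blast
  have Bdiff: "x - y \<in> B" if xy: "x \<in> B" "y \<in> B" for x y
  proof -
    obtain m n m' n' where "x = of_int (m * p + n * q) * e\<^sub>1 + of_int (n * r) * e\<^sub>2"
      "y = of_int (m' * p + n' * q) * e\<^sub>1 + of_int (n' * r) * e\<^sub>2" using xy unfolding B by blast
    then have "x - y = of_int ((m - m') * p + (n - n') * q) * e\<^sub>1 + of_int ((n - n') * r) * e\<^sub>2"
      by (simp add: algebra_simps)
    then show ?thesis unfolding B by blast
  qed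
  have B0: "0 \<in> B" using mem[of 0 0] by force
  have Badd: "x + y \<in> B" if "x \<in> B" "y \<in> B" for x y
    using Bdiff[OF that(1) Bdiff[OF B0 that(2)]] by simp
  define coset where "coset = (\<lambda>x. (\<lambda>b. x + b) ` B)"
  have coset_eq: "coset x = coset y \<longleftrightarrow> x - y \<in> B" for x y
  proof
    assume "coset x = coset y"
    then have "x + 0 \<in> coset y" using B0 by (auto simp: coset_def)
    then show "x - y \<in> B" by (auto simp: coset_def)
  next
    assume d: "x - y \<in> B"
    have "x + b = y + ((x - y) + b) \<and> y + b = x + (b - (x - y))" for b by simp
    then show "coset x = coset y" using d Badd Bdiff unfolding coset_def by blast
  qed
  define f where "f = (\<lambda>(i, j). coset (of_int i * e\<^sub>1 + of_int j * e\<^sub>2))"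
  have "bij_betw f ({0..<p} \<times> {0..<r}) (coset ` A)"
  proof (rule bij_betw_imageI)
    show "inj_on f ({0..<p} \<times> {0..<r})"
    proof (rule inj_onI, clarify)
      fix i j i' j' assume ij: "i \<in> {0..<p}" "j \<in> {0..<r}" "i' \<in> {0..<p}" "j' \<in> {0..<r}"
        and "f (i, j) = f (i', j')"
      then have "of_int (i - i') * e\<^sub>1 + of_int (j - j') * e\<^sub>2 \<in> B"
        by (simp add: f_def coset_eq algebra_simps)
      then obtain m n where mn: "i - i' = m * p + n * q" "j - j' = n * r" using mem by blast
      \<comment> \<open>A multiple of \<open>r\<close> smaller than \<open>r\<close> in absolute
        value is zero; after that the same holds for \<open>p\<close>.\<close>
      have "\<bar>n * r\<bar> < 1 * r" using ij unfolding mn(2)[symmetric] by auto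
      then have n: "n = 0" using pr by (simp add: abs_mult mult_less_cancel_right del: mult_1)
      have "\<bar>m * p\<bar> < 1 * p" using ij mn(1) n by auto
      then have "m = 0" using pr by (simp add: abs_mult mult_less_cancel_right del: mult_1)
      with n mn show "i = i' \<and> j = j'" by simp
    qed
    show "f ` ({0..<p} \<times> {0..<r}) = coset ` A"
    proof (intro equalityI subsetI)
      fix y assume "y \<in> coset ` A"
      then obtain a b where y: "y = coset (of_int a * e\<^sub>1 + of_int b * e\<^sub>2)" unfolding A by blast
      define n where "n = b div r"
      define m where "m = (a - n * q) div p"
      have "a = (a - n * q) mod p + (m * p + n * q)" "b = b mod r + n * r"
        unfolding m_def n_def by (simp_all add: algebra_simps)
      then have "of_int (a - (a - n * q) mod p) * e\<^sub>1 + of_int (b - b mod r) * e\<^sub>2 \<in> B"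
        using mem by (metis add_diff_cancel_left')
      then have "y = f ((a - n * q) mod p, b mod r)"
        unfolding y f_def by (simp add: coset_eq algebra_simps)
      then show "y \<in> f ` ({0..<p} \<times> {0..<r})" using pr by auto
    qed (use A in \<open>auto simp: f_def\<close>)
  qed
  then have "card (coset ` A) = card ({0..<p} \<times> {0..<r})" by (rule bij_betw_same_card[symmetric])
  then show ?thesis using pr by (simp add: additive_index_def coset_def nat_mult_distrib)
qed

definition int_indep :: "real \<Rightarrow> real \<Rightarrow> bool" where
  "int_indep x y \<longleftrightarrow> (\<forall>m n :: int. of_int m * x + of_int n * y = 0 \<longrightarrow> m = 0 \<and> n = 0)"

definition int_span :: "real \<Rightarrow> real \<Rightarrow> real set" where
  "int_span x y = {of_int m * x + of_int n * y | m n :: int. True}"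

lemma Z_basis_iff: "Z_basis A x y \<longleftrightarrow> A = int_span x y \<and> int_indep x y"
proof -
  let ?f = "\<lambda>(m::int, n::int). of_int m * x + of_int n * y"
  have "inj ?f \<longleftrightarrow> int_indep x y"
  proof
    assume inj: "inj ?f"
    have "m = 0 \<and> n = 0" if "of_int m * x + of_int n * y = 0" for m n
      using injD[OF inj, of "(m, n)" "(0, 0)"] that by simp
    then show "int_indep x y" by (simp add: int_indep_def)
  next
    assume ind: "int_indep x y"
    show "inj ?f"
    proof (rule injI, clarify)
      fix m n m' n' :: int
      assume "of_int m * x + of_int n * y = of_int m' * x + of_int n' * y"
      then have "of_int (m - m') * x + of_int (n - n') * y = 0" by (simp add: algebra_simps)
      then have "m - m' = 0 \<and> n - n' = 0" using ind unfolding int_indep_def by blast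
      then show "m = m' \<and> n = n'" by simp
    qed
  qed
  moreover have "range ?f = int_span x y" by (auto simp: int_span_def)
  ultimately show ?thesis by (auto simp: Z_basis_def bij_betw_def)
qed

lemma int_spanI: "of_int m * x + of_int n * y \<in> int_span x y"
  by (auto simp: int_span_def)

lemma int_span_basis: "x \<in> int_span x y" "y \<in> int_span x y"
  using int_spanI[of 1 x 0 y] int_spanI[of 0 x 1 y] by simp_all

lemma int_span_diff: "u \<in> int_span x y \<Longrightarrow> v \<in> int_span x y \<Longrightarrow> u - v \<in> int_span x y"
proof -
  assume "u \<in> int_span x y" "v \<in> int_span x y"
  then obtain m n m' n' where "u = of_int m * x + of_int n * y" "v = of_int m' * x + of_int n' * y"
    by (auto simp: int_span_def)
  then have "u - v = of_int (m - m') * x + of_int (n - n') * y" by (simp add: algebra_simps)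
  then show ?thesis using int_spanI by metis
qed

lemma Z_basis_swap: "Z_basis A x y \<Longrightarrow> Z_basis A y x"
proof -
  have "int_span x y = int_span y x" unfolding int_span_def by (metis add.commute)
  moreover have "int_indep x y \<longleftrightarrow> int_indep y x" unfolding int_indep_def by (metis add.commute)
  ultimately show "Z_basis A x y \<Longrightarrow> Z_basis A y x" by (simp add: Z_basis_iff)
qed

lemma Z_basis_scale:
  assumes "Z_basis A x y" "c \<noteq> 0"
  shows "Z_basis ((\<lambda>u. c * u) ` A) (c * x) (c * y)"
proof -
  have comb: "of_int m * (c * x) + of_int n * (c * y) = c * (of_int m * x + of_int n * y)" for m n :: int
    by (simp add: algebra_simps)
  have "int_span (c * x) (c * y) = (\<lambda>u. c * u) ` int_span x y"
    unfolding int_span_def comb by blast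
  moreover have "int_indep x y \<Longrightarrow> int_indep (c * x) (c * y)"
    unfolding int_indep_def comb using assms(2) by simp
  ultimately show ?thesis using assms(1) by (simp add: Z_basis_iff)
qed

text \<open>The Hermite basis, transported from coordinates. Existence and index come together
  because one triangular basis yields both.\<close>

lemma sublattice_basis:
  assumes A: "Z_basis A x y" and B: "B \<subseteq> A" and diff: "\<And>u v. u \<in> B \<Longrightarrow> v \<in> B \<Longrightarrow> u - v \<in> B"
    and P: "P > 0" "of_int P * x \<in> B" "of_int P * y \<in> B"
  obtains p q r :: int where "p > 0" "r > 0" "Z_basis B (of_int p * x) (of_int q * x + of_int r * y)"
    "additive_index A B = nat (p * r)"
proof -
  have Aeq: "A = int_span x y" and ind: "int_indep x y" using A by (auto simp: Z_basis_iff)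
  define H where "H = {(m, n). of_int m * x + of_int n * y \<in> B}"
  obtain p q r where pr: "p > 0" "r > 0" and H: "H = {(m * p + n * q, n * r) | m n. True}"
  proof (rule sublattice_hermite_basis[of H P])
    fix a b c d assume "(a, b) \<in> H" "(c, d) \<in> H"
    then have "(of_int a * x + of_int b * y) - (of_int c * x + of_int d * y) \<in> B"
      using diff by (auto simp: H_def)
    then show "(a - c, b - d) \<in> H" by (simp add: H_def algebra_simps)
  qed (use P in \<open>auto simp: H_def\<close>)
  have Beq: "B = {of_int (m * p + n * q) * x + of_int (n * r) * y | m n. True}" (is "B = ?R")
  proof (intro equalityI subsetI)
    fix u assume u: "u \<in> B"
    then obtain m n where mn: "u = of_int m * x + of_int n * y" using B Aeq by (auto simp: int_span_def)
    then have "(m, n) \<in> H" using u by (simp add: H_def)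
    then show "u \<in> ?R" unfolding H mn by blast
  next
    fix u assume "u \<in> ?R"
    then obtain m n where u: "u = of_int (m * p + n * q) * x + of_int (n * r) * y" by blast
    have "(m * p + n * q, n * r) \<in> H" unfolding H by blast
    then show "u \<in> B" unfolding H_def u by blast
  qed
  have comb: "of_int m * (of_int p * x) + of_int n * (of_int q * x + of_int r * y)
      = of_int (m * p + n * q) * x + of_int (n * r) * y" for m n
    by (simp add: algebra_simps)
  have "Z_basis B (of_int p * x) (of_int q * x + of_int r * y)"
    unfolding Z_basis_iff int_span_def int_indep_def comb
  proof (intro conjI allI impI)
    show "B = ?R" by (rule Beq)
    fix m n :: int assume "of_int (m * p + n * q) * x + of_int (n * r) * y = 0"
    then have "m * p + n * q = 0 \<and> n * r = 0" using ind unfolding int_indep_def by blast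
    then show "m = 0" "n = 0" using pr by auto
  qed
  moreover have "additive_index A B = nat (p * r)"
    using additive_index_hermite[of x y p r A B q] ind pr Aeq Beq
    unfolding int_indep_def int_span_def by blast
  ultimately show thesis using pr that by blast
qed

section \<open>Arithmetic of a quadratic field\<close>

text \<open>A normal form of the field: with an integral square, the generator \<open>\<xi>\<close>
  is an algebraic integer, and conjugation just changes its sign.\<close>

locale quadratic_field =
  fixes K :: "real set" and \<xi> :: real and N :: int
  assumes K_eq: "K = {p + q * \<xi> | p q. p \<in> \<rat> \<and> q \<in> \<rat>}"
    and irrational: "\<xi> \<notin> \<rat>"
    and square: "\<xi> * \<xi> = of_int N"
begin

section \<open>Coordinates and Galois conjugation\<close>

lemma coords_eq:
  assumes "p \<in> \<rat>" "q \<in> \<rat>" "p' \<in> \<rat>" "q' \<in> \<rat>" "p + q * \<xi> = p' + q' * \<xi>"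
  shows "p = p' \<and> q = q'"
proof -
  have "q = q'"
  proof (rule ccontr)
    assume "q \<noteq> q'"
    then have "\<xi> = (p' - p) / (q - q')" using assms by (simp add: field_simps)
    then show False using assms irrational by (metis Rats_diff Rats_divide)
  qed
  with assms show ?thesis by simp
qed

lemma K_cases:
  assumes "x \<in> K"
  obtains p q where "p \<in> \<rat>" "q \<in> \<rat>" "x = p + q * \<xi>"
  using assms K_eq by auto

lemma K_comb: "p \<in> \<rat> \<Longrightarrow> q \<in> \<rat> \<Longrightarrow> p + q * \<xi> \<in> K"
  using K_eq by auto

lemma rat_in_K: "p \<in> \<rat> \<Longrightarrow> p \<in> K"
  using K_comb[of p 0] by simp

lemma xi_in_K: "\<xi> \<in> K"
  using K_comb[of 0 1] by simp

lemma mult_comb: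
  "(p + q * \<xi>) * (p' + q' * \<xi>) = (p * p' + of_int N * q * q') + (p * q' + q * p') * \<xi>"
  by (simp add: algebra_simps flip: square)

lemma K_add: "x \<in> K \<Longrightarrow> y \<in> K \<Longrightarrow> x + y \<in> K"
proof (elim K_cases)
  fix p q p' q' assume "p \<in> \<rat>" "q \<in> \<rat>" "p' \<in> \<rat>" "q' \<in> \<rat>" "x = p + q * \<xi>" "y = p' + q' * \<xi>"
  then have "x + y = (p + p') + (q + q') * \<xi>" by (simp add: algebra_simps)
  then show "x + y \<in> K" using \<open>p \<in> \<rat>\<close> \<open>q \<in> \<rat>\<close> \<open>p' \<in> \<rat>\<close> \<open>q' \<in> \<rat>\<close> by (simp add: K_comb)
qed

lemma K_mult: "x \<in> K \<Longrightarrow> y \<in> K \<Longrightarrow> x * y \<in> K"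
  by (elim K_cases) (simp add: mult_comb K_comb)

lemma K_uminus: "x \<in> K \<Longrightarrow> - x \<in> K"
  using K_mult[of "-1" x] rat_in_K[of "-1"] by simp

text \<open>The explicit candidate for the automorphism; it is the identity outside \<open>K\<close>
  to match the normalization in \<open>galois_conj\<close>.\<close>

definition conj_fun :: "real \<Rightarrow> real" where
  "conj_fun x = (if x \<in> K then THE y. \<exists>p\<in>\<rat>. \<exists>q\<in>\<rat>. x = p + q * \<xi> \<and> y = p - q * \<xi> else x)"

lemma conj_fun_comb:
  assumes "p \<in> \<rat>" "q \<in> \<rat>"
  shows "conj_fun (p + q * \<xi>) = p - q * \<xi>"
proof -
  have "(THE y. \<exists>p'\<in>\<rat>. \<exists>q'\<in>\<rat>. p + q * \<xi> = p' + q' * \<xi> \<and> y = p' - q' * \<xi>) = p - q * \<xi>"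
    using assms coords_eq by (intro the_equality) blast+
  then show ?thesis using assms K_comb by (simp add: conj_fun_def)
qed

text \<open>Uniqueness: an automorphism fixes the rationals and the square of \<open>\<xi>\<close>,
  so it sends \<open>\<xi>\<close> to \<open>\<xi>\<close> or \<open>- \<xi>\<close>, and being
  nontrivial rules out the former.\<close>

lemma galois_conj_eq: "galois_conj K = conj_fun"
  unfolding galois_conj_def
proof (rule the_equality, intro conjI ballI allI impI)
  have in_K: "conj_fun x \<in> K" if "x \<in> K" for x
    using that by (elim K_cases) (use K_comb[of _ "- _"] in \<open>simp add: conj_fun_comb\<close>)
  have invol: "conj_fun (conj_fun x) = x" if x: "x \<in> K" for x
  proof -
    obtain p q where pq: "p \<in> \<rat>" "q \<in> \<rat>" "x = p + q * \<xi>" using x by (rule K_cases)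
    then show ?thesis using conj_fun_comb[of p "- q"] by (simp add: conj_fun_comb)
  qed
  show "bij_betw conj_fun K K"
    using in_K invol by (intro bij_betw_byWitness[where f' = conj_fun]) auto
  show "conj_fun 1 = 1" using conj_fun_comb[of 1 0] by simp
  show "conj_fun x = x" if "x \<notin> K" for x using that by (simp add: conj_fun_def)
  show "\<exists>x\<in>K. conj_fun x \<noteq> x"
    using conj_fun_comb[of 0 1] xi_in_K irrational by (intro bexI[of _ \<xi>]) auto
next
  fix x y assume "x \<in> K" "y \<in> K"
  then obtain p q p' q' where pq: "p \<in> \<rat>" "q \<in> \<rat>" "p' \<in> \<rat>" "q' \<in> \<rat>"
    and xy: "x = p + q * \<xi>" "y = p' + q' * \<xi>"
    by (metis K_cases)
  have "x + y = (p + p') + (q + q') * \<xi>" by (simp add: xy algebra_simps)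
  then have "conj_fun (x + y) = (p + p') - (q + q') * \<xi>" using pq by (simp only: conj_fun_comb Rats_add)
  then show "conj_fun (x + y) = conj_fun x + conj_fun y"
    unfolding xy conj_fun_comb[OF pq(1,2)] conj_fun_comb[OF pq(3,4)] by (simp add: algebra_simps)
  have "(p - q * \<xi>) * (p' - q' * \<xi>) = (p * p' + of_int N * q * q') - (p * q' + q * p') * \<xi>"
    by (simp add: algebra_simps flip: square)
  then show "conj_fun (x * y) = conj_fun x * conj_fun y"
    using pq by (simp add: xy conj_fun_comb mult_comb)
next
  fix \<sigma> :: "real \<Rightarrow> real"
  assume *: "bij_betw \<sigma> K K \<and> \<sigma> 1 = 1 \<and>
    (\<forall>x\<in>K. \<forall>y\<in>K. \<sigma> (x + y) = \<sigma> x + \<sigma> y \<and> \<sigma> (x * y) = \<sigma> x * \<sigma> y) \<and>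
    (\<exists>x\<in>K. \<sigma> x \<noteq> x) \<and> (\<forall>x. x \<notin> K \<longrightarrow> \<sigma> x = x)"
  have add: "\<sigma> (x + y) = \<sigma> x + \<sigma> y" and mult: "\<sigma> (x * y) = \<sigma> x * \<sigma> y"
    if "x \<in> K" "y \<in> K" for x y using * that by auto
  have one: "\<sigma> 1 = 1" and zero: "\<sigma> 0 = 0" using * add[of 0 0] rat_in_K[of 0] by auto
  have nat: "\<sigma> (of_nat n) = of_nat n" for n
    by (induction n) (use zero one add rat_in_K in auto)
  have neg: "\<sigma> (- x) = - \<sigma> x" if "x \<in> K" for x
    using add[OF that K_uminus[OF that]] zero by simp
  have int: "\<sigma> (of_int n) = of_int n" for n
    using nat[of "nat n"] neg[of "of_int (- n)"] nat[of "nat (- n)"] rat_in_K[of "of_int (- n)"]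
    by (cases "n \<ge> 0") auto
  have rat: "\<sigma> p = p" if "p \<in> \<rat>" for p
  proof -
    obtain a b where p: "p = of_int a / of_int b" "b > 0" using \<open>p \<in> \<rat>\<close> by (rule Rats_cases')
    have "\<sigma> p * of_int b = \<sigma> (p * of_int b)" using mult rat_in_K that int by simp
    also have "p * of_int b = of_int a" using p by simp
    also have "\<sigma> (of_int a) = of_int a" by (rule int)
    finally have "\<sigma> p = of_int a / of_int b" using p(2) by (simp add: eq_divide_eq)
    then show ?thesis using p(1) by simp
  qed
  have comb: "\<sigma> (p + q * \<xi>) = p + q * \<sigma> \<xi>" if "p \<in> \<rat>" "q \<in> \<rat>" for p q
    using that by (simp add: add mult rat rat_in_K xi_in_K K_mult)
  have "\<sigma> \<xi> * \<sigma> \<xi> = \<xi> * \<xi>" using mult[OF xi_in_K xi_in_K] square int by simp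
  then have "\<sigma> \<xi> = \<xi> \<or> \<sigma> \<xi> = - \<xi>" using square_eq_iff by blast
  moreover have "\<sigma> \<xi> \<noteq> \<xi>" using comb * by (metis K_cases)
  ultimately have "\<sigma> \<xi> = - \<xi>" by simp
  then have "\<sigma> (p + q * \<xi>) = conj_fun (p + q * \<xi>)" if "p \<in> \<rat>" "q \<in> \<rat>" for p q
    using that by (simp add: comb conj_fun_comb)
  then have "\<sigma> x = conj_fun x" if "x \<in> K" for x using that by (metis K_cases)
  moreover have "\<sigma> x = conj_fun x" if "x \<notin> K" for x using * that by (simp add: conj_fun_def)
  ultimately show "\<sigma> = conj_fun" by blast
qed

abbreviation cj :: "real \<Rightarrow> real" where "cj \<equiv> galois_conj K"

lemma cj_comb: "p \<in> \<rat> \<Longrightarrow> q \<in> \<rat> \<Longrightarrow> cj (p + q * \<xi>) = p - q * \<xi>"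
  by (simp add: galois_conj_eq conj_fun_comb)

lemma cj_rat: "p \<in> \<rat> \<Longrightarrow> cj p = p"
  using cj_comb[of p 0] by simp

lemma cj_xi: "cj \<xi> = - \<xi>"
  using cj_comb[of 0 1] by simp

lemma cj_in_K: "x \<in> K \<Longrightarrow> cj x \<in> K"
  by (elim K_cases) (use K_comb[of _ "- _"] in \<open>simp add: cj_comb\<close>)

lemma cj_cj: "x \<in> K \<Longrightarrow> cj (cj x) = x"
  by (elim K_cases) (use cj_comb[of _ "- _"] in \<open>simp add: cj_comb\<close>)

lemma cj_add:
  assumes "x \<in> K" "y \<in> K"
  shows "cj (x + y) = cj x + cj y"
proof -
  obtain p q p' q' where pq: "p \<in> \<rat>" "q \<in> \<rat>" "p' \<in> \<rat>" "q' \<in> \<rat>"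
    and xy: "x = p + q * \<xi>" "y = p' + q' * \<xi>"
    using assms by (metis K_cases)
  have "x + y = (p + p') + (q + q') * \<xi>" by (simp add: xy algebra_simps)
  then have "cj (x + y) = (p + p') - (q + q') * \<xi>" using pq by (simp only: cj_comb Rats_add)
  then show ?thesis
    unfolding xy cj_comb[OF pq(1,2)] cj_comb[OF pq(3,4)] by (simp add: algebra_simps)
qed

lemma cj_mult:
  assumes "x \<in> K" "y \<in> K"
  shows "cj (x * y) = cj x * cj y"
proof -
  obtain p q p' q' where pq: "p \<in> \<rat>" "q \<in> \<rat>" "p' \<in> \<rat>" "q' \<in> \<rat>"
    and xy: "x = p + q * \<xi>" "y = p' + q' * \<xi>"
    using assms by (metis K_cases)
  have "(p - q * \<xi>) * (p' - q' * \<xi>) = (p * p' + of_int N * q * q') - (p * q' + q * p') * \<xi>"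
    by (simp add: algebra_simps flip: square)
  then show ?thesis using pq by (simp add: xy cj_comb mult_comb)
qed

lemma cj_int_comb:
  assumes "x \<in> K" "y \<in> K"
  shows "cj (of_int m * x + of_int n * y) = of_int m * cj x + of_int n * cj y"
  using assms by (simp add: cj_add cj_mult cj_rat K_mult rat_in_K)

lemma cj_eq_self_iff:
  assumes "x \<in> K"
  shows "cj x = x \<longleftrightarrow> x \<in> \<rat>"
proof
  obtain p q where pq: "p \<in> \<rat>" "q \<in> \<rat>" "x = p + q * \<xi>" using assms by (rule K_cases)
  assume "cj x = x"
  then have "q * \<xi> = 0" using pq by (simp add: cj_comb)
  then have "q = 0" using irrational by auto
  then show "x \<in> \<rat>" using pq by simp
qed (rule cj_rat)

section \<open>Traces, norms and the ring of integers\<close>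

lemma trace_rat: "x \<in> K \<Longrightarrow> x + cj x \<in> \<rat>"
  by (elim K_cases) (simp add: cj_comb)

lemma norm_rat: "x \<in> K \<Longrightarrow> x * cj x \<in> \<rat>"
  using cj_eq_self_iff[of "x * cj x"] by (simp add: K_mult cj_in_K cj_mult cj_cj mult.commute)

lemma cj_eq_0_iff: "x \<in> K \<Longrightarrow> cj x = 0 \<longleftrightarrow> x = 0"
  using cj_cj[of x] cj_rat[of 0] by auto

lemma quadratic_eq: "x * x = (x + cj x) * x - x * cj x"
  by (simp add: algebra_simps)

abbreviation ZK :: "real set" where "ZK \<equiv> ring_of_integers K"

text \<open>For irrational \<open>x\<close>, trace and norm are the coefficients of its quadratic
  equation, so \<open>algebraic_int_quadratic\<close> applies. For rational \<open>x\<close> the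
  norm is its square, whose integrality forces that of \<open>x\<close>.\<close>

lemma ZK_iff: "x \<in> ZK \<longleftrightarrow> x \<in> K \<and> x + cj x \<in> \<int> \<and> x * cj x \<in> \<int>"
proof (cases "x \<in> K")
  case K: True
  show ?thesis
  proof (cases "x \<in> \<rat>")
    case True
    have "x \<in> \<int>" if "x * x \<in> \<int>"
    proof -
      have "algebraic_int x"
        using algebraic_int_if_quadratic[of 0 "- (x * x)" x] that by simp
      then show ?thesis using True rational_algebraic_int_is_int by blast
    qed
    then have "x \<in> \<int> \<longleftrightarrow> x + x \<in> \<int> \<and> x * x \<in> \<int>" by (auto intro: Ints_add Ints_mult)
    moreover have "algebraic_int x \<longleftrightarrow> x \<in> \<int>"
      using rational_algebraic_int_is_int[OF _ True] int_imp_algebraic_int[of x] by argo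
    ultimately show ?thesis
      using K unfolding ring_of_integers_def mem_Collect_eq cj_rat[OF True] by argo
  next
    case False
    have "x + cj x \<in> \<int> \<and> x * cj x \<in> \<int>" if "algebraic_int x"
      by (intro conjI; rule algebraic_int_quadratic[OF that False trace_rat[OF K] norm_rat[OF K] quadratic_eq])
    moreover have "algebraic_int x" if "x + cj x \<in> \<int> \<and> x * cj x \<in> \<int>"
      using that quadratic_eq[of x] by (intro algebraic_int_if_quadratic) blast+
    ultimately show ?thesis using K unfolding ring_of_integers_def mem_Collect_eq by argo
  qed
qed (simp add: ring_of_integers_def)

lemma ZK_subset_K: "ZK \<subseteq> K" by (auto simp: ZK_iff)

lemma ZK_rat_iff: "x \<in> \<rat> \<Longrightarrow> x \<in> ZK \<longleftrightarrow> x \<in> \<int>"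
  using rat_in_K[of x] rational_algebraic_int_is_int[of x] int_imp_algebraic_int[of x]
  unfolding ring_of_integers_def mem_Collect_eq by argo

lemma int_in_ZK: "of_int n \<in> ZK"
  using ZK_rat_iff[of "of_int n"] by simp

lemma xi_in_ZK: "\<xi> \<in> ZK"
  by (simp add: ZK_iff xi_in_K cj_xi square)

lemma cj_in_ZK: "x \<in> ZK \<Longrightarrow> cj x \<in> ZK"
  by (simp add: ZK_iff cj_in_K cj_cj add.commute mult.commute)

text \<open>The traces of \<open>x * cj y\<close> and of \<open>x * y\<close> are rational numbers with integral sum and
  product, hence integers.\<close>

lemma mixed_trace_int:
  assumes "x \<in> ZK" "y \<in> ZK"
  shows "x * cj y + cj x * y \<in> \<int>"
proof -
  have K: "x \<in> K" "y \<in> K" and int: "x + cj x \<in> \<int>" "y + cj y \<in> \<int>" "x * cj x \<in> \<int>" "y * cj y \<in> \<int>"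
    using assms by (auto simp: ZK_iff)
  define s where "s = x * cj y + cj x * y"
  define u where "u = x * y + cj x * cj y"
  have su: "s + u = (x + cj x) * (y + cj y)" by (simp add: s_def u_def algebra_simps)
  have "s * u = y * cj y * ((x + cj x)\<^sup>2 - 2 * (x * cj x)) + x * cj x * ((y + cj y)\<^sup>2 - 2 * (y * cj y))"
    by (simp add: s_def u_def algebra_simps power2_eq_square)
  then have su2: "s * u \<in> \<int>"
    using int by (simp add: power2_eq_square)
  have "algebraic_int s"
  proof (rule algebraic_int_if_quadratic)
    show "s + u \<in> \<int>" using int su by simp
    show "s * u \<in> \<int>" by (rule su2)
    show "s * s = (s + u) * s - s * u" by (simp add: algebra_simps)
  qed
  moreover have "s \<in> \<rat>"
    using trace_rat[of "x * cj y"] K by (simp add: s_def K_mult cj_in_K cj_mult cj_cj)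
  ultimately show ?thesis using rational_algebraic_int_is_int by (auto simp: s_def)
qed

text \<open>The norm of a sum is the sum of the norms plus the mixed trace.\<close>

lemma ZK_add:
  assumes "x \<in> ZK" "y \<in> ZK"
  shows "x + y \<in> ZK"
proof -
  have K: "x \<in> K" "y \<in> K" and int: "x + cj x \<in> \<int>" "y + cj y \<in> \<int>" "x * cj x \<in> \<int>" "y * cj y \<in> \<int>"
    using assms by (auto simp: ZK_iff)
  have "(x + y) + cj (x + y) = (x + cj x) + (y + cj y)" using K by (simp add: cj_add)
  moreover have "(x + y) * cj (x + y) = x * cj x + y * cj y + (x * cj y + cj x * y)"
    using K by (simp add: cj_add algebra_simps)
  ultimately show ?thesis using int mixed_trace_int[OF assms] K
    unfolding ZK_iff by (metis Ints_add K_add)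
qed

text \<open>The trace of \<open>x * y\<close> is the mixed trace of \<open>x\<close> and
  \<open>cj y\<close>.\<close>

lemma ZK_mult:
  assumes "x \<in> ZK" "y \<in> ZK"
  shows "x * y \<in> ZK"
proof -
  have K: "x \<in> K" "y \<in> K" and int: "x * cj x \<in> \<int>" "y * cj y \<in> \<int>"
    using assms by (auto simp: ZK_iff)
  have "x * y + cj (x * y) \<in> \<int>"
    using mixed_trace_int[OF assms(1) cj_in_ZK[OF assms(2)]] K by (simp add: cj_mult cj_cj)
  moreover have "x * y * cj (x * y) = (x * cj x) * (y * cj y)"
    using K by (simp add: cj_mult algebra_simps)
  ultimately show ?thesis using int K unfolding ZK_iff by (metis Ints_mult K_mult)
qed

lemma ZK_uminus: "x \<in> ZK \<Longrightarrow> - x \<in> ZK"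
  using ZK_mult[OF int_in_ZK[of "-1"]] by simp

lemma ZK_diff: "x \<in> ZK \<Longrightarrow> y \<in> ZK \<Longrightarrow> x - y \<in> ZK"
  using ZK_add[of x "- y"] ZK_uminus[of y] by simp

text \<open>The determinant of the conjugates of \<open>x\<close> and \<open>y\<close>, a signed
  square root of the discriminant of their lattice. Left unsquared, it scales by the determinant of
  a base change.\<close>

definition disc_root :: "real \<Rightarrow> real \<Rightarrow> real" where
  "disc_root x y = x * cj y - cj x * y"

lemma disc_root_comb:
  assumes "x \<in> K" "y \<in> K"
  shows "disc_root (of_int a * x + of_int b * y) (of_int c * x + of_int d * y)
    = of_int (a * d - b * c) * disc_root x y"
  unfolding disc_root_def cj_int_comb[OF assms] by (simp add: algebra_simps)

lemma disc_root_mult: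
  assumes "x \<in> K" "y \<in> K" "z \<in> K"
  shows "disc_root (z * x) (z * y) = z * cj z * disc_root x y"
  using assms by (simp add: disc_root_def cj_mult algebra_simps)

text \<open>One direction is Cramer's rule. For the other, a zero value makes
  \<open>y * cj x\<close> self-conjugate, hence rational, and then
  \<open>(x * cj x) * y = (y * cj x) * x\<close> is a rational dependence.\<close>

lemma disc_root_nonzero:
  assumes "x \<in> K" "y \<in> K"
  shows "disc_root x y \<noteq> 0 \<longleftrightarrow> int_indep x y"
proof
  assume nz: "disc_root x y \<noteq> 0"
  show "int_indep x y"
    unfolding int_indep_def
  proof (intro allI impI)
    fix m n :: int assume eq: "of_int m * x + of_int n * y = 0"
    have eq': "of_int m * cj x + of_int n * cj y = 0"
      using cj_int_comb[OF assms, of m n] eq cj_rat[of 0] by simp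
    have "of_int m * disc_root x y
        = (of_int m * x + of_int n * y) * cj y - (of_int m * cj x + of_int n * cj y) * y"
      by (simp add: disc_root_def algebra_simps)
    then have m: "of_int m * disc_root x y = 0" unfolding eq eq' by simp
    have "of_int n * disc_root x y
        = (of_int m * cj x + of_int n * cj y) * x - (of_int m * x + of_int n * y) * cj x"
      by (simp add: disc_root_def algebra_simps)
    then have "of_int n * disc_root x y = 0" unfolding eq eq' by simp
    with m nz show "m = 0 \<and> n = 0" by simp
  qed
next
  assume ind: "int_indep x y"
  show "disc_root x y \<noteq> 0"
  proof
    assume "disc_root x y = 0"
    then have "cj (y * cj x) = y * cj x"
      using assms by (simp add: disc_root_def cj_mult cj_in_K cj_cj mult.commute)
    then have "y * cj x \<in> \<rat>" using cj_eq_self_iff assms by (simp add: K_mult cj_in_K)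
    then obtain a b where ab: "y * cj x = of_int a / of_int b" "b > 0" by (rule Rats_cases')
    obtain c d where cd: "x * cj x = of_int c / of_int d" "d > 0"
      using norm_rat[OF assms(1)] by (rule Rats_cases')
    have "x \<noteq> 0" using ind unfolding int_indep_def by (metis add.right_neutral mult_zero_left mult_zero_right of_int_0 zero_neq_one)
    then have "c \<noteq> 0" using cd cj_eq_0_iff assms by auto
    have "(x * cj x) * y = (y * cj x) * x" by simp
    then have "of_int (- a * d) * x + of_int (c * b) * y = 0"
      using ab(2) cd(2) unfolding ab(1) cd(1) by (simp add: field_simps)
    then have "c * b = 0" using ind unfolding int_indep_def by blast
    then show False using \<open>c \<noteq> 0\<close> ab by simp
  qed
qed

lemma Z_basis_in_K:
  assumes "Z_basis A x y" "A \<subseteq> K"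
  shows "x \<in> K" "y \<in> K" "disc_root x y \<noteq> 0" "x \<in> A" "y \<in> A"
proof -
  show *: "x \<in> A" "y \<in> A" using assms by (auto simp: Z_basis_iff int_span_basis)
  then show "x \<in> K" "y \<in> K" using assms by auto
  then show "disc_root x y \<noteq> 0" using assms disc_root_nonzero by (auto simp: Z_basis_iff)
qed

lemma disc_root_sublattice:
  assumes "Z_basis A x y" "A \<subseteq> K" "u \<in> A" "v \<in> A"
  obtains a b c d :: int where "u = of_int a * x + of_int b * y" "v = of_int c * x + of_int d * y"
    "disc_root u v = of_int (a * d - b * c) * disc_root x y"
proof -
  obtain a b c d :: int where "u = of_int a * x + of_int b * y" "v = of_int c * x + of_int d * y"
    using assms by (auto simp: Z_basis_iff int_span_def)
  with that disc_root_comb Z_basis_in_K(1,2)[OF assms(1,2)] show thesis by blast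
qed

text \<open>Each value is a nonzero integer multiple of the other.\<close>

lemma disc_root_bases:
  assumes "Z_basis A x y" "Z_basis A u v" "A \<subseteq> K"
  shows "\<bar>disc_root x y\<bar> = \<bar>disc_root u v\<bar>"
proof -
  have le: "\<bar>disc_root x y\<bar> \<le> \<bar>disc_root u v\<bar>" if xy: "Z_basis A x y" and uv: "Z_basis A u v" for x y u v
  proof -
    obtain k :: int where k: "disc_root u v = of_int k * disc_root x y"
      using disc_root_sublattice[OF xy assms(3), of u v] Z_basis_in_K[OF uv assms(3)] by metis
    then have "k \<noteq> 0" using Z_basis_in_K(3)[OF uv assms(3)] by auto
    then have "1 * \<bar>disc_root x y\<bar> \<le> of_int \<bar>k\<bar> * \<bar>disc_root x y\<bar>" by (intro mult_right_mono) linarith+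
    then show ?thesis by (simp add: k abs_mult)
  qed
  show ?thesis using le assms by (simp add: order_antisym)
qed

text \<open>For a Hermite basis of \<open>B\<close> the determinant \<open>p * r\<close> is both the
  index and the ratio of the two values; any other basis gives the same absolute value.\<close>

lemma additive_index_disc_root:
  assumes A: "Z_basis A x y" "A \<subseteq> K" and B: "Z_basis B u v" "B \<subseteq> A"
  shows "real (additive_index A B) * \<bar>disc_root x y\<bar> = \<bar>disc_root u v\<bar>"
proof -
  have BK: "B \<subseteq> K" using A B by blast
  note xy = Z_basis_in_K[OF A] and uv = Z_basis_in_K[OF B(1) BK]
  obtain a b c d where abcd: "u = of_int a * x + of_int b * y" "v = of_int c * x + of_int d * y"
    and D: "disc_root u v = of_int (a * d - b * c) * disc_root x y"
    using disc_root_sublattice[OF A, of u v] uv B by blast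
  define D where "D = a * d - b * c"
  have "disc_root u v = of_int D * disc_root x y" unfolding D_def by (rule D)
  then have D0: "D \<noteq> 0" using uv(3) by auto
  have Bspan: "B = int_span u v" using B by (simp add: Z_basis_iff)
  \<comment> \<open>Cramer's rule places \<open>D\<close> times the basis of \<open>A\<close> inside
    \<open>B\<close>, which supplies the multiple for \<open>sublattice_basis\<close>.\<close>
  have "of_int D * x = of_int d * u + of_int (- b) * v" "of_int D * y = of_int (- c) * u + of_int a * v"
    by (simp_all add: abcd D_def algebra_simps)
  then have "of_int D * x \<in> B" "of_int D * y \<in> B" unfolding Bspan by (simp_all only: int_spanI)
  moreover have "of_int \<bar>D\<bar> * w \<in> B" if "of_int D * w \<in> B" for w
    using that int_span_diff[of 0 u v "of_int D * w"] int_spanI[of 0 u 0 v]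
    by (cases "D \<ge> 0") (simp_all add: Bspan)
  ultimately have "of_int \<bar>D\<bar> * x \<in> B" "of_int \<bar>D\<bar> * y \<in> B" by blast+
  then obtain p q r where pr: "p > 0" "r > 0" "Z_basis B (of_int p * x) (of_int q * x + of_int r * y)"
    "additive_index A B = nat (p * r)"
    using sublattice_basis[OF A(1) B(2), of "\<bar>D\<bar>"] D0 int_span_diff Bspan by (metis zero_less_abs_iff)
  have "disc_root (of_int p * x) (of_int q * x + of_int r * y) = of_int (p * r) * disc_root x y"
    using disc_root_comb[OF xy(1,2), of p 0 q r] by simp
  then have "\<bar>disc_root (of_int p * x) (of_int q * x + of_int r * y)\<bar> = real (additive_index A B) * \<bar>disc_root x y\<bar>"
    using pr by (simp add: abs_mult)
  then show ?thesis using disc_root_bases[OF pr(3) B(1) BK] by simp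
qed

text \<open>The ring of integers lies in the trace dual of the lattice of 1 and \<open>\<xi>\<close>
  and contains \<open>2 * \<bar>N\<bar>\<close> times that dual.\<close>

lemma ZK_basis_exists: "\<exists>x y. Z_basis ZK x y"
proof -
  \<comment> \<open>The basis dual to 1 and \<open>\<xi>\<close> under the trace form: the
    coordinates of \<open>x\<close> are the traces of \<open>x\<close> and of
    \<open>x * \<xi>\<close>.\<close>
  define e\<^sub>1 :: real where "e\<^sub>1 = 1 / 2"
  define e\<^sub>2 where "e\<^sub>2 = 1 / (2 * of_int N) * \<xi>"
  have N0: "N \<noteq> 0" using square irrational by auto
  have K: "e\<^sub>1 \<in> K" "e\<^sub>2 \<in> K" using K_comb[of "1/2" 0] K_comb[of 0 "1 / (2 * of_int N)"]
    by (simp_all add: e\<^sub>1_def e\<^sub>2_def)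
  have "cj e\<^sub>1 = e\<^sub>1" "cj e\<^sub>2 = - e\<^sub>2" using cj_comb[of 0 "1 / (2 * of_int N)"]
    by (simp_all add: e\<^sub>1_def e\<^sub>2_def cj_rat)
  then have "disc_root e\<^sub>1 e\<^sub>2 = - e\<^sub>2" by (simp add: disc_root_def) (simp add: e\<^sub>1_def)
  also have "\<dots> \<noteq> 0" using N0 irrational by (auto simp: e\<^sub>2_def)
  finally have "int_indep e\<^sub>1 e\<^sub>2" using disc_root_nonzero K by blast
  then have basis: "Z_basis (int_span e\<^sub>1 e\<^sub>2) e\<^sub>1 e\<^sub>2" by (simp add: Z_basis_iff)
  have "ZK \<subseteq> int_span e\<^sub>1 e\<^sub>2"
  proof
    fix x assume x: "x \<in> ZK"
    then obtain p q where pq: "p \<in> \<rat>" "q \<in> \<rat>" "x = p + q * \<xi>"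
      using ZK_subset_K by (metis K_cases subsetD)
    have "x + cj x = 2 * p" using pq by (simp add: cj_comb)
    then obtain m where m: "2 * p = of_int m" using x by (metis ZK_iff Ints_cases)
    have xxi: "x * \<xi> = of_int N * q + p * \<xi>" by (simp add: pq(3) algebra_simps flip: square)
    then have "x * \<xi> + cj (x * \<xi>) = 2 * of_int N * q" using pq by (simp add: cj_comb)
    then obtain n where n: "2 * of_int N * q = of_int n"
      using ZK_mult[OF x xi_in_ZK] by (metis ZK_iff Ints_cases)
    have "x = of_int m * e\<^sub>1 + of_int n * e\<^sub>2"
      unfolding pq(3) m[symmetric] n[symmetric] e\<^sub>1_def e\<^sub>2_def using N0 by simp
    then show "x \<in> int_span e\<^sub>1 e\<^sub>2" by (simp add: int_spanI)
  qed
  moreover have "of_int (2 * \<bar>N\<bar>) * e\<^sub>1 \<in> ZK" using int_in_ZK[of "\<bar>N\<bar>"] by (simp add: e\<^sub>1_def)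
  moreover have "of_int (2 * \<bar>N\<bar>) * e\<^sub>2 = \<xi> \<or> of_int (2 * \<bar>N\<bar>) * e\<^sub>2 = - \<xi>"
    using N0 by (simp add: e\<^sub>2_def abs_if)
  then have "of_int (2 * \<bar>N\<bar>) * e\<^sub>2 \<in> ZK" using xi_in_ZK ZK_uminus by metis
  ultimately show ?thesis
    using sublattice_basis[OF basis, of ZK "2 * \<bar>N\<bar>"] ZK_diff N0 by (metis mult_pos_pos zero_less_abs_iff zero_less_numeral)
qed

text \<open>Integrality holds as the square is a squared mixed trace minus four times a product of
  norms; uniqueness is \<open>disc_root_bases\<close>.\<close>

lemma field_discriminant_eq:
  assumes "Z_basis ZK x y"
  shows "of_int (field_discriminant K) = (disc_root x y)\<^sup>2"
proof -
  note xy = Z_basis_in_K[OF assms ZK_subset_K]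
  have "(disc_root x y)\<^sup>2 = (x * cj y + cj x * y)\<^sup>2 - 4 * ((x * cj x) * (y * cj y))"
    by (simp add: disc_root_def power2_eq_square algebra_simps)
  also have "\<dots> \<in> \<int>" using mixed_trace_int[OF xy(4,5)] xy(4,5) by (auto simp: ZK_iff)
  finally obtain D where D: "(disc_root x y)\<^sup>2 = of_int D" by (auto elim: Ints_cases)
  have "field_discriminant K = D"
    unfolding field_discriminant_def
  proof (rule the_equality)
    show "\<exists>u v. Z_basis ZK u v \<and> of_int D = (u * cj v - cj u * v)\<^sup>2"
      using assms D unfolding disc_root_def by metis
    fix D' assume "\<exists>u v. Z_basis ZK u v \<and> of_int D' = (u * cj v - cj u * v)\<^sup>2"
    then obtain u v where uv: "Z_basis ZK u v" "of_int D' = (disc_root u v)\<^sup>2"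
      by (auto simp: disc_root_def)
    have "\<bar>disc_root x y\<bar> = \<bar>disc_root u v\<bar>" by (rule disc_root_bases[OF assms uv(1) ZK_subset_K])
    then have "(disc_root x y)\<^sup>2 = (disc_root u v)\<^sup>2" by (metis power2_abs)
    then have "of_int D' = (of_int D :: real)" using uv(2) D by simp
    then show "D' = D" by simp
  qed
  then show ?thesis using D by simp
qed

lemma sqrt_field_discriminant:
  assumes "Z_basis ZK x y"
  shows "sqrt (of_int (field_discriminant K)) = \<bar>disc_root x y\<bar>"
  by (simp add: field_discriminant_eq[OF assms])

lemma field_discriminant_pos: "field_discriminant K > 0"
proof -
  obtain x y where xy: "Z_basis ZK x y" using ZK_basis_exists by blast
  have "(disc_root x y)\<^sup>2 > 0" using Z_basis_in_K[OF xy ZK_subset_K] by simp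
  then show ?thesis unfolding field_discriminant_eq[OF xy, symmetric] by simp
qed

text \<open>Conjugation negates the nonzero \<open>disc_root x y\<close>, but fixes every
  rational.\<close>

lemma field_discriminant_nonsquare: "sqrt (of_int (field_discriminant K)) \<notin> \<rat>"
proof
  obtain x y where basis: "Z_basis ZK x y" using ZK_basis_exists by blast
  note xy = Z_basis_in_K[OF basis ZK_subset_K]
  assume "sqrt (of_int (field_discriminant K)) \<in> \<rat>"
  then have "disc_root x y \<in> \<rat>"
    unfolding sqrt_field_discriminant[OF basis] by (metis Rats_abs_iff)
  then have "cj (disc_root x y) = disc_root x y" by (rule cj_rat)
  moreover have "cj (disc_root x y) = - disc_root x y"
  proof -
    have "cj (disc_root x y) = cj (of_int 1 * (x * cj y) + of_int (- 1) * (cj x * y))"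
      by (simp add: disc_root_def)
    also have "\<dots> = - disc_root x y"
      using xy by (subst cj_int_comb) (simp_all add: K_mult cj_in_K cj_mult cj_cj disc_root_def)
    finally show ?thesis .
  qed
  ultimately show False using xy(3) by simp
qed

subsection \<open>Fractional ideals and their forms\<close>

text \<open>The norm of a denominator is again a denominator, and \<open>ideal_norm\<close> asks for
  a rational integer.\<close>

lemma fractional_ideal_denominator:
  assumes "A \<in> fractional_ideals K"
  shows "\<exists>M>0. \<forall>x\<in>A. of_int M * x \<in> ZK"
proof -
  obtain c where c: "c \<in> ZK" "c \<noteq> 0" "\<And>x. x \<in> A \<Longrightarrow> c * x \<in> ZK"
    using assms unfolding fractional_ideals_def image_subset_iff by blast
  obtain M where M: "c * cj c = of_int M" using c(1) by (metis ZK_iff Ints_cases)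
  have "c \<in> K" using c(1) ZK_subset_K by blast
  then have M0: "M \<noteq> 0" using c(2) M cj_eq_0_iff by auto
  have "of_int M * x \<in> ZK" if "x \<in> A" for x
    using ZK_mult[OF cj_in_ZK[OF c(1)] c(3)[OF that]] by (simp add: mult_ac flip: M)
  then have "of_int \<bar>M\<bar> * x \<in> ZK" if "x \<in> A" for x
    using that ZK_uminus by (cases "M \<ge> 0") fastforce+
  then show ?thesis using M0 by (intro exI[of _ "\<bar>M\<bar>"]) auto
qed

context
  fixes A :: "real set"
  assumes A: "A \<in> fractional_ideals K"
begin

lemma
  shows ideal_subset_K: "A \<subseteq> K"
    and ideal_add: "x \<in> A \<Longrightarrow> y \<in> A \<Longrightarrow> x + y \<in> A"
    and ideal_mult: "r \<in> ZK \<Longrightarrow> x \<in> A \<Longrightarrow> r * x \<in> A"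
  using A by (auto simp: fractional_ideals_def)

lemma ideal_diff: "x \<in> A \<Longrightarrow> y \<in> A \<Longrightarrow> x - y \<in> A"
  using ideal_add[of x "- y"] ideal_mult[OF int_in_ZK[of "- 1"], of y] by simp

text \<open>The ideal lies in the ring of integers scaled by \<open>1 / of_int M\<close>.
  Conversely, the norm of a nonzero integral \<open>y\<close> in the ideal is a multiple of
  \<open>y\<close>, so it carries integers into the ideal.\<close>

lemma ideal_basis_exists: "\<exists>x y. Z_basis A x y"
proof -
  obtain M where M: "M > 0" "\<And>x. x \<in> A \<Longrightarrow> of_int M * x \<in> ZK"
    using fractional_ideal_denominator[OF A] by blast
  obtain w\<^sub>1 w\<^sub>2 where w: "Z_basis ZK w\<^sub>1 w\<^sub>2" using ZK_basis_exists by blast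
  note wK = Z_basis_in_K[OF w ZK_subset_K]
  define e\<^sub>1 e\<^sub>2 where "e\<^sub>1 = w\<^sub>1 / of_int M" and "e\<^sub>2 = w\<^sub>2 / of_int M"
  have we: "w\<^sub>1 = of_int M * e\<^sub>1" "w\<^sub>2 = of_int M * e\<^sub>2" using M by (simp_all add: e\<^sub>1_def e\<^sub>2_def)
  have "Z_basis ((\<lambda>u. 1 / of_int M * u) ` ZK) e\<^sub>1 e\<^sub>2"
    using Z_basis_scale[OF w, of "1 / of_int M"] M by (simp add: e\<^sub>1_def e\<^sub>2_def)
  then have basis: "Z_basis (int_span e\<^sub>1 e\<^sub>2) e\<^sub>1 e\<^sub>2" by (simp add: Z_basis_iff)
  have sub: "A \<subseteq> int_span e\<^sub>1 e\<^sub>2"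
  proof
    fix x assume "x \<in> A"
    then obtain m n where "of_int M * x = of_int m * w\<^sub>1 + of_int n * w\<^sub>2"
      using M(2) w by (fastforce simp: Z_basis_iff int_span_def)
    then have "of_int M * x = of_int M * (of_int m * e\<^sub>1 + of_int n * e\<^sub>2)"
      unfolding we by (simp add: algebra_simps)
    then have "x = of_int m * e\<^sub>1 + of_int n * e\<^sub>2" using M(1) by simp
    then show "x \<in> int_span e\<^sub>1 e\<^sub>2" by (simp add: int_spanI)
  qed
  obtain x where x: "x \<in> A" "x \<noteq> 0" using A by (auto simp: fractional_ideals_def)
  define y where "y = of_int M * x"
  have y: "y \<in> A" "y \<in> ZK" "y \<noteq> 0" using x M ideal_mult[OF int_in_ZK] by (auto simp: y_def)
  obtain k where k: "y * cj y = of_int k" using y(2) by (metis ZK_iff Ints_cases)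
  have "k \<noteq> 0" using k y ZK_subset_K cj_eq_0_iff[of y] by auto
  \<comment> \<open>The factor \<open>sgn k\<close> replaces the norm of \<open>y\<close> by its
    absolute value, since \<open>sublattice_basis\<close> wants a positive multiple.\<close>
  have *: "of_int (\<bar>k\<bar> * M) * e \<in> A" if "of_int M * e \<in> ZK" for e
  proof -
    have "of_int (sgn k) * (cj y * (of_int M * e)) \<in> ZK"
      by (intro ZK_mult int_in_ZK cj_in_ZK y that)
    then have "of_int (sgn k) * (cj y * (of_int M * e)) * y \<in> A" by (rule ideal_mult[OF _ y(1)])
    also have "of_int (sgn k) * (cj y * (of_int M * e)) * y = of_int (sgn k) * (y * cj y) * of_int M * e"
      by simp
    also have "\<dots> = of_int (\<bar>k\<bar> * M) * e" unfolding k by (simp add: abs_sgn mult.commute)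
    finally show ?thesis .
  qed
  have "\<bar>k\<bar> * M > 0" using \<open>k \<noteq> 0\<close> M by simp
  then show ?thesis
    using sublattice_basis[OF basis sub ideal_diff _ *[of e\<^sub>1] *[of e\<^sub>2]] wK(4,5) we by metis
qed

text \<open>Scaling by the chosen \<open>k\<close> multiplies the value of \<open>disc_root\<close>
  by the square of \<open>k\<close>, which the definition divides out; so the choice does not
  matter.\<close>

lemma ideal_norm_eq:
  assumes "Z_basis A x y" "Z_basis ZK w\<^sub>1 w\<^sub>2"
  shows "ideal_norm K A = \<bar>disc_root x y\<bar> / \<bar>disc_root w\<^sub>1 w\<^sub>2\<bar>"
proof -
  note xy = Z_basis_in_K[OF assms(1) ideal_subset_K]
  note w = Z_basis_in_K[OF assms(2) ZK_subset_K]
  define P where "P = (\<lambda>k::int. k \<noteq> 0 \<and> (\<lambda>x. of_int k * x) ` A \<subseteq> ZK)"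
  obtain M where "M > 0" "\<forall>x\<in>A. of_int M * x \<in> ZK" using fractional_ideal_denominator[OF A] by blast
  then have "\<exists>k. P k" unfolding P_def by (intro exI[of _ M]) auto
  then have P: "P (SOME k. P k)" by (rule someI_ex)
  define k where "k = (SOME k. P k)"
  have k: "k \<noteq> 0" "(\<lambda>x. of_int k * x) ` A \<subseteq> ZK" using P by (auto simp: P_def k_def)
  define B where "B = (\<lambda>x. of_int k * x) ` A"
  have "Z_basis B (of_int k * x) (of_int k * y)"
    unfolding B_def using Z_basis_scale assms(1) k(1) by simp
  then have "additive_index ZK B * \<bar>disc_root w\<^sub>1 w\<^sub>2\<bar> = \<bar>disc_root (of_int k * x) (of_int k * y)\<bar>"
    using additive_index_disc_root[OF assms(2) ZK_subset_K] k B_def by blast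
  also have "disc_root (of_int k * x) (of_int k * y) = (of_int k)\<^sup>2 * disc_root x y"
    using disc_root_mult[OF xy(1,2), of "of_int k"] rat_in_K cj_rat by (simp add: power2_eq_square)
  finally have "additive_index ZK B * \<bar>disc_root w\<^sub>1 w\<^sub>2\<bar> = (of_int k)\<^sup>2 * \<bar>disc_root x y\<bar>"
    by (simp add: abs_mult)
  then have "additive_index ZK B / (of_int k)\<^sup>2 = \<bar>disc_root x y\<bar> / \<bar>disc_root w\<^sub>1 w\<^sub>2\<bar>"
    using k w(3) by (simp add: field_simps)
  moreover have "ideal_norm K A = additive_index ZK B / (of_int k)\<^sup>2"
    unfolding ideal_norm_def P_def[symmetric] k_def[symmetric] B_def Let_def ..
  ultimately show ?thesis by simp
qed

text \<open>Multiplying an integral basis by \<open>z\<close> lands in \<open>A\<close> and scales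
  \<open>disc_root\<close> by the norm of \<open>z\<close>. The result is an integer multiple of the
  value for \<open>A\<close>.\<close>

lemma norm_over_ideal_norm_int:
  assumes "z \<in> A"
  shows "z * cj z / ideal_norm K A \<in> \<int>"
proof -
  obtain x y where xy: "Z_basis A x y" using ideal_basis_exists by blast
  obtain w\<^sub>1 w\<^sub>2 where w: "Z_basis ZK w\<^sub>1 w\<^sub>2" using ZK_basis_exists by blast
  note xyK = Z_basis_in_K[OF xy ideal_subset_K] and wK = Z_basis_in_K[OF w ZK_subset_K]
  have "z * w\<^sub>1 \<in> A" "z * w\<^sub>2 \<in> A" using ideal_mult[OF _ assms] wK by (simp_all add: mult.commute)
  then obtain k :: int where k: "disc_root (z * w\<^sub>1) (z * w\<^sub>2) = of_int k * disc_root x y"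
    using disc_root_sublattice[OF xy ideal_subset_K] by metis
  have "z * cj z * disc_root w\<^sub>1 w\<^sub>2 = of_int k * disc_root x y"
    using k disc_root_mult wK ideal_subset_K assms by auto
  then have "z * cj z = of_int k * disc_root x y / disc_root w\<^sub>1 w\<^sub>2"
    using wK(3) by (simp add: field_simps)
  then have "z * cj z / ideal_norm K A = of_int k \<or> z * cj z / ideal_norm K A = of_int (- k)"
    unfolding ideal_norm_eq[OF xy w] using wK(3) xyK(3) by (auto simp: abs_if)
  then show ?thesis by (metis Ints_of_int)
qed

text \<open>The middle coefficient is integral by polarization, from the values at \<open>x\<close>,
  \<open>y\<close> and \<open>x + y\<close>.\<close>

lemma ideal_form_exists:
  assumes "Z_basis A x y"
  shows "\<exists>a b c. ideal_form K A x y a b c"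
proof -
  note xy = Z_basis_in_K[OF assms ideal_subset_K]
  let ?n = "ideal_norm K A"
  obtain a where a: "x * cj x / ?n = of_int a" using norm_over_ideal_norm_int[OF xy(4)] by (metis Ints_cases)
  obtain c where c: "y * cj y / ?n = of_int c" using norm_over_ideal_norm_int[OF xy(5)] by (metis Ints_cases)
  obtain s where s: "(x + y) * cj (x + y) / ?n = of_int s"
    using norm_over_ideal_norm_int[OF ideal_add[OF xy(4,5)]] by (metis Ints_cases)
  have "(x * cj y + y * cj x) / ?n = (x + y) * cj (x + y) / ?n - x * cj x / ?n - y * cj y / ?n"
    using xy by (simp add: cj_add algebra_simps flip: add_divide_distrib diff_divide_distrib)
  then have b: "(x * cj y + y * cj x) / ?n = of_int (s - a - c)" using a c s by simp
  have "(X * x + Y * y) * (X * cj x + Y * cj y) / ?n =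
      of_int a * X\<^sup>2 + of_int (s - a - c) * X * Y + of_int c * Y\<^sup>2" for X Y
    unfolding a[symmetric] b[symmetric] c[symmetric]
    by (simp add: algebra_simps power2_eq_square add_divide_distrib)
  then show ?thesis unfolding ideal_form_def by blast
qed

text \<open>Multiplied by the squared ideal norm, the discriminant of the form is the squared
  \<open>disc_root x y\<close>; the ideal norm is the ratio of this root to that of the ring of
  integers.\<close>

lemma ideal_form_discriminant:
  assumes "Z_basis A x y" "ideal_form K A x y a b c"
  shows "b\<^sup>2 - 4 * a * c = field_discriminant K"
proof -
  obtain w\<^sub>1 w\<^sub>2 where w: "Z_basis ZK w\<^sub>1 w\<^sub>2" using ZK_basis_exists by blast
  note xy = Z_basis_in_K[OF assms(1) ideal_subset_K] and wK = Z_basis_in_K[OF w ZK_subset_K]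
  let ?n = "ideal_norm K A"
  have n: "?n = \<bar>disc_root x y\<bar> / \<bar>disc_root w\<^sub>1 w\<^sub>2\<bar>" by (rule ideal_norm_eq[OF assms(1) w])
  then have n0: "?n \<noteq> 0" using xy(3) wK(3) by simp
  have form: "(X * x + Y * y) * (X * cj x + Y * cj y) = ?n * (of_int a * X\<^sup>2 + of_int b * X * Y + of_int c * Y\<^sup>2)" for X Y
    using assms(2) n0 unfolding ideal_form_def by (metis mult.commute nonzero_eq_divide_eq)
  have a: "x * cj x = ?n * of_int a" using form[of 1 0] by simp
  have c: "y * cj y = ?n * of_int c" using form[of 0 1] by simp
  have b: "x * cj y + cj x * y = ?n * of_int b"
    using form[of 1 1] a c by (simp add: algebra_simps)
  have "?n\<^sup>2 * of_int (b\<^sup>2 - 4 * a * c) = (?n * of_int b)\<^sup>2 - 4 * (?n * of_int a) * (?n * of_int c)"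
    by (simp add: algebra_simps power2_eq_square)
  also have "\<dots> = (disc_root x y)\<^sup>2"
    unfolding a[symmetric] b[symmetric] c[symmetric]
    by (simp add: disc_root_def algebra_simps power2_eq_square)
  also have "\<dots> = ?n\<^sup>2 * (disc_root w\<^sub>1 w\<^sub>2)\<^sup>2"
    unfolding n using wK(3) by (simp add: power_divide)
  also have "(disc_root w\<^sub>1 w\<^sub>2)\<^sup>2 = of_int (field_discriminant K)"
    by (rule field_discriminant_eq[OF w, symmetric])
  finally have "real_of_int (b\<^sup>2 - 4 * a * c) = of_int (field_discriminant K)"
    using n0 by (metis mult_left_cancel power_not_zero)
  then show ?thesis by (simp only: of_int_eq_iff)
qed

lemma oriented_basis_exists: "\<exists>x y. oriented_basis K A x y"
proof -
  obtain x y where xy: "Z_basis A x y" using ideal_basis_exists by blast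
  have "disc_root x y < 0 \<or> disc_root x y > 0" using Z_basis_in_K[OF xy ideal_subset_K] by linarith
  then have "cj x * y - x * cj y > 0 \<or> cj y * x - y * cj x > 0"
    by (auto simp: disc_root_def mult.commute)
  then show ?thesis using xy Z_basis_swap unfolding oriented_basis_def by blast
qed

end

end

section \<open>Narrow ideal classes\<close>

text \<open>Extending 1 to a rational basis of \<open>K\<close> yields an irrational
  \<open>\<theta>\<close>; completing the square and clearing a denominator normalizes it.\<close>

lemma real_quadratic_field_generator:
  assumes "real_quadratic_field K"
  obtains \<xi> N where "quadratic_field K \<xi> N"
proof -
  interpret V: vector_space "\<lambda>(q::rat) (x::real). of_rat q * x"
    by unfold_locales (auto simp: of_rat_add of_rat_mult algebra_simps)
  have K: "0 \<in> K" "1 \<in> K" and add: "x \<in> K \<Longrightarrow> y \<in> K \<Longrightarrow> x + y \<in> K"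
    and diff: "x \<in> K \<Longrightarrow> y \<in> K \<Longrightarrow> x - y \<in> K" and mult: "x \<in> K \<Longrightarrow> y \<in> K \<Longrightarrow> x * y \<in> K"
    and inv: "x \<in> K \<Longrightarrow> inverse x \<in> K" and dim: "V.dim K = 2" for x y
    using assms by (auto simp: real_quadratic_field_def)
  have nat: "of_nat n \<in> K" for n by (induction n) (auto simp: K add)
  have int: "of_int m \<in> K" for m
    using nat[of "nat m"] diff[OF K(1) nat[of "nat (- m)"]] by (cases "m \<ge> 0") auto
  have rat: "p \<in> K" if p: "p \<in> \<rat>" for p
  proof -
    obtain a b where "p = of_int a / of_int b" "b > 0" using p by (rule Rats_cases')
    then show ?thesis using mult[OF int inv[OF int]] by (simp add: divide_inverse)
  qed
  have "V.independent {1}" by (simp add: V.dependent_single)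
  then obtain B where B: "{1} \<subseteq> B" "B \<subseteq> K" "V.independent B" "K \<subseteq> V.span B"
    using V.maximal_independent_subset_extend[of "{1}" K] K by auto
  then have "card B = 2" using V.basis_card_eq_dim dim by metis
  then obtain \<theta> where \<theta>: "B = {1, \<theta>}" "\<theta> \<noteq> 1" using B(1) by (auto simp: card_2_iff)
  have span: "\<exists>p\<in>\<rat>. \<exists>q\<in>\<rat>. x = p + q * \<theta>" if x: "x \<in> K" for x
  proof -
    have "x \<in> V.span {\<theta>, 1}" using B(4) x \<theta>(1) by (auto simp: insert_commute)
    then obtain k l where "x - of_rat k * \<theta> = of_rat l * 1"
      by (auto simp: V.span_insert V.span_singleton)
    then have "x = of_rat l + of_rat k * \<theta>" by (simp add: algebra_simps)
    then show ?thesis by (metis Rats_of_rat)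
  qed
  have irr: "\<theta> \<notin> \<rat>"
  proof
    assume "\<theta> \<in> \<rat>"
    then obtain r where "\<theta> = of_rat r" by (rule Rats_cases)
    then have "\<theta> \<in> V.span {1}" by (auto simp: V.span_singleton)
    moreover have "B - {\<theta>} = {1}" using \<theta> by auto
    ultimately show False using B(3) \<theta>(1) unfolding V.dependent_def by auto
  qed
  have "\<theta> \<in> K" using B(2) \<theta>(1) by auto
  then obtain a b where ab: "a \<in> \<rat>" "b \<in> \<rat>" "\<theta> * \<theta> = a + b * \<theta>" using span mult by blast
  \<comment> \<open>The shift removes the linear term of the quadratic equation.\<close>
  define \<eta> where "\<eta> = \<theta> - b / 2"
  have \<eta>\<eta>: "\<eta> * \<eta> = a + b * b / 4" using ab(3) by (simp add: \<eta>_def algebra_simps)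
  then have "\<eta> * \<eta> \<in> \<rat>" using ab by simp
  then obtain c d where cd: "\<eta> * \<eta> = of_int c / of_int d" "d > 0" by (rule Rats_cases')
  \<comment> \<open>One factor \<open>d\<close> cancels the denominator of the square, leaving the
    integer \<open>c * d\<close>.\<close>
  define \<xi> where "\<xi> = of_int d * \<eta>"
  have \<theta>_eq: "\<theta> = b / 2 + \<xi> / of_int d" using cd(2) by (simp add: \<xi>_def \<eta>_def)
  have "quadratic_field K \<xi> (c * d)"
  proof
    have "\<xi> * \<xi> = of_int d * of_int d * (\<eta> * \<eta>)" by (simp add: \<xi>_def)
    also have "\<dots> = of_int (c * d)" using cd by simp
    finally show "\<xi> * \<xi> = of_int (c * d)" .
    show "\<xi> \<notin> \<rat>"
    proof
      assume "\<xi> \<in> \<rat>"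
      then have "\<theta> \<in> \<rat>" using ab unfolding \<theta>_eq by simp
      with irr show False ..
    qed
    show "K = {p + q * \<xi> | p q. p \<in> \<rat> \<and> q \<in> \<rat>}"
    proof (intro equalityI subsetI)
      fix x assume "x \<in> K"
      then obtain p q where pq: "p \<in> \<rat>" "q \<in> \<rat>" "x = p + q * \<theta>" using span by blast
      have "x = (p + q * b / 2) + (q / of_int d) * \<xi>" unfolding pq(3) \<theta>_eq by (simp add: algebra_simps)
      moreover have "p + q * b / 2 \<in> \<rat>" "q / of_int d \<in> \<rat>" using pq ab by simp_all
      ultimately show "x \<in> {p + q * \<xi> | p q. p \<in> \<rat> \<and> q \<in> \<rat>}" by blast
    next
      fix x assume "x \<in> {p + q * \<xi> | p q. p \<in> \<rat> \<and> q \<in> \<rat>}"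
      then obtain p q where "p \<in> \<rat>" "q \<in> \<rat>" "x = p + q * \<xi>" by blast
      moreover have "\<xi> \<in> K" unfolding \<xi>_def \<eta>_def
        using mult[OF int diff[OF \<open>\<theta> \<in> K\<close> rat[of "b / 2"]]] ab by simp
      ultimately show "x \<in> K" using add mult rat by blast
    qed
  qed
  then show thesis by (rule that)
qed

text \<open>The Pell equation makes \<open>x\<close> and \<open>z * b\<close> congruent modulo 2, so
  the diagonal is \<open>u\<close> and \<open>u + z * b\<close> without division; it then reads as
  four times the determinant condition.\<close>

lemma fundamental_automorphism_matrix:
  assumes "b\<^sup>2 - 4 * a * c = D" "x\<^sup>2 - D * z\<^sup>2 = 4"
  obtains W where "fundamental_automorphism a b c x z = psl_class W" "det W = 1" "trace W = x"
proof -
  have eq: "x\<^sup>2 - (z * b)\<^sup>2 = 4 * (1 - a * c * z\<^sup>2)"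
    using assms(2) unfolding assms(1)[symmetric] by (simp add: algebra_simps power2_eq_square)
  then have "even (x\<^sup>2 - (z * b)\<^sup>2)" by simp
  then have "even (x - z * b)" by simp
  then obtain u where u: "x - z * b = 2 * u" by blast
  have x: "x = 2 * u + z * b" using u by simp
  have "x + z * b = 2 * (u + z * b)" unfolding x by (simp add: algebra_simps)
  then have "(x - z * b) div 2 = u" "(x + z * b) div 2 = u + z * b"
    using u by presburger+
  then have "fundamental_automorphism a b c x z = psl_class (mat2 u (- c * z) (a * z) (u + z * b))"
    unfolding fundamental_automorphism_def by simp
  moreover have "4 * (u * (u + z * b) - (- c * z) * (a * z)) = 4 * 1"
    using eq unfolding x by (simp add: algebra_simps power2_eq_square)
  then have "det (mat2 u (- c * z) (a * z) (u + z * b)) = 1"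
    unfolding det_mat2 by (metis mult_left_cancel zero_neq_numeral)
  moreover have "trace (mat2 u (- c * z) (a * z) (u + z * b)) = x" unfolding trace_mat2 x by simp
  ultimately show thesis by (rule that)
qed

lemma (in quadratic_field) narrow_ideal_class_subset:
  assumes "C \<in> narrow_ideal_classes K"
  shows "C \<subseteq> fractional_ideals K" "C \<noteq> {}"
proof -
  obtain A where A: "A \<in> fractional_ideals K" "C = narrow_equiv K `` {A}"
    using assms unfolding narrow_ideal_classes_def by (auto elim: quotientE)
  show "C \<subseteq> fractional_ideals K" unfolding A(2) narrow_equiv_def by auto
  have "(A, A) \<in> narrow_equiv K"
    unfolding narrow_equiv_def using A(1) cj_rat[of 1] rat_in_K[of 1] by (auto intro: bexI[of _ 1])
  then show "C \<noteq> {}" unfolding A(2) by blast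
qed

text \<open>Each class giving rise to a solution is rendered by a nonempty set of tuples, all of
  which solve the equation. Choosing \<open>z\<close> ahead of the class makes it depend on
  \<open>K\<close> alone.\<close>

theorem theorem3p4:
  fixes K :: "real set"
  assumes "real_quadratic_field K"
  shows "\<exists>z::int. \<forall>C\<in>narrow_ideal_classes K.
           class_tuples K C \<noteq> {} \<and>
           (\<forall>t\<in>class_tuples K C. \<exists>k>0. length t = k \<and>
              (lucas t)\<^sup>2 - 4 = z\<^sup>2 * field_discriminant K)"
proof -
  obtain \<xi> N where "quadratic_field K \<xi> N" using assms by (rule real_quadratic_field_generator)
  then interpret quadratic_field K \<xi> N .
  let ?D = "field_discriminant K"
  obtain x z where pell: "pell_fundamental ?D x z"
    using pell_fundamental_exists[OF field_discriminant_nonsquare field_discriminant_pos] by blast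
  then have xz: "x > 0" "z > 0" "x\<^sup>2 - ?D * z\<^sup>2 = 4" by (auto simp: pell_fundamental_def)
  \<comment> \<open>A positive discriminant pushes \<open>x\<close> beyond 2, so the automorphism is
    hyperbolic.\<close>
  have "?D * z\<^sup>2 > 0" using field_discriminant_pos xz by simp
  then have "2\<^sup>2 < x\<^sup>2" using xz by simp
  then have x3: "x \<ge> 3" using xz(1) power2_less_imp_less[of 2 x] by simp
  show ?thesis
  proof (intro exI[of _ z] ballI conjI)
    fix C assume C: "C \<in> narrow_ideal_classes K"
    then obtain A where A: "A \<in> C" "A \<in> fractional_ideals K"
      using narrow_ideal_class_subset by blast
    obtain u v where uv: "oriented_basis K A u v" using oriented_basis_exists[OF A(2)] by blast
    then have basis: "Z_basis A u v" by (simp add: oriented_basis_def)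
    obtain a b c where form: "ideal_form K A u v a b c" using ideal_form_exists[OF A(2) basis] by blast
    obtain W where W: "fundamental_automorphism a b c x z = psl_class W" "det W = 1" "trace W = x"
      using fundamental_automorphism_matrix[OF ideal_form_discriminant[OF A(2) basis form] xz(3)] .
    obtain t where t: "t \<noteq> []" "pos_tuple t" "conj_SL2 W (lucas_matrix t)"
      using conj_SL2_lucas_matrix W x3 by blast
    have "conjugate_in PSL2Z (fundamental_automorphism a b c x z) (psl_word t)"
      using t unfolding W(1) psl_word_eq_psl_class[OF t(2)] conjugate_in_psl_class conj_SL2_def by blast
    then have "t \<in> class_tuples K C"
      using t A uv form pell unfolding class_tuples_def by blast
    then show "class_tuples K C \<noteq> {}" by blast
  next
    fix C t assume C: "C \<in> narrow_ideal_classes K" and "t \<in> class_tuples K C"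
    then obtain A u v a b c x' z' where t: "t \<noteq> []" "pos_tuple t" and A: "A \<in> C"
      and basis: "oriented_basis K A u v" and form: "ideal_form K A u v a b c"
      and pell': "pell_fundamental ?D x' z'"
      and conj: "conjugate_in PSL2Z (fundamental_automorphism a b c x' z') (psl_word t)"
      unfolding class_tuples_def by blast
    have A': "A \<in> fractional_ideals K" using narrow_ideal_class_subset C A by blast
    have basis: "Z_basis A u v" using basis by (simp add: oriented_basis_def)
    have xz': "z' > 0" "x'\<^sup>2 - ?D * z'\<^sup>2 = 4" using pell' by (auto simp: pell_fundamental_def)
    \<comment> \<open>The tuple brings its own Pell solution; minimality of both second components
      identifies them.\<close>
    have "z' = z" using pell pell' unfolding pell_fundamental_def by (meson order_antisym)
    obtain W where W: "fundamental_automorphism a b c x' z' = psl_class W" "det W = 1" "trace W = x'"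
      using fundamental_automorphism_matrix[OF ideal_form_discriminant[OF A' basis form] xz'(2)] .
    obtain B where "conj_SL2 W B" "lucas_matrix t = B \<or> lucas_matrix t = - B"
      using conj unfolding W(1) psl_word_eq_psl_class[OF t(2)] conjugate_in_psl_class conj_SL2_def by blast
    moreover have "trace (- B) = - trace B" by (cases B rule: mat2_cases) simp
    \<comment> \<open>The trace is known only up to the sign lost in PSL2, and squaring removes
      it.\<close>
    ultimately have "(lucas t)\<^sup>2 = x'\<^sup>2"
      using trace_conj_SL2 W(3) unfolding lucas_def by (metis power2_minus)
    then have "(lucas t)\<^sup>2 - 4 = z\<^sup>2 * ?D" using xz'(2) \<open>z' = z\<close> by (simp add: mult.commute)
    then show "\<exists>k>0. length t = k \<and> (lucas t)\<^sup>2 - 4 = z\<^sup>2 * ?D" using t(1) by simp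
  qed
qed

end
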